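(* In the setting and notation given in the context (generalized linear model with covariates missing completely at random; fixed numbers $K$ of covariates and $S$ of candidate models; all limits as $n\to\infty$), suppose that (i) for every $s\in\{1,\ldots,S\}$, $\hat\beta_{(s)}-\beta^*_{(s)}=O_p(n^{-1/2})$; (ii) $\|\tilde X^{T}\mu\|=O(n)$, $\|\tilde X^{T}\epsilon\|=O_p(n^{1/2})$, and, uniformly for $w\in\mathscr{W}$, $$\Big\|\frac{\partial B(\beta)}{\partial\beta^{T}}\Big|_{\beta=\tilde\beta(w)}\Big\|=O_p(n)$$ for every $\tilde\beta(w)$ between $\hat\beta(w)$ and $\beta^*(w)$; (iii) uniformly for $s\in\{1,\ldots,S\}$, $n^{-1}\overline{\sigma}^{2}\|\theta(\beta^*_{(s)})\|^{2}=O(1)$; (iv) $n\,\xi_n^{-2}=o(1)$; (v) $n^{-1/2}\lambda_n=O(1)$. Let $\hat w=\operatorname{argmin}_{w\in\mathscr{W}}\mathscr{G}(w)$. Then $$\frac{KL(\hat w)}{\inf_{w\in\mathscr{W}}KL(w)}\longrightarrow 1$$ in probability as $n\to\infty$.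
   Context: **Data generating process.** For $i=1,\ldots,n$ the independent responses $y_i$ have density (or probability mass function) $f(\cdot\,|\theta_{0,i},\phi)$, where $$f(y_i|\theta_i,\phi)=\exp\Big\{\frac{y_i\theta_i-b(\theta_i)}{\phi}+c(y_i,\phi)\Big\},$$ $b(\cdot)$ and $c(\cdot,\cdot)$ are known functions, $\phi$ is known, and $\theta_{0,i}$ is the true (nonrandom) value of the canonical parameter $\theta_i$. The candidate models postulate $\theta_i=x_i^{T}\beta$, with $x_i$ a $K$-dimensional covariate vector and $\beta\in\mathbb{R}^K$, $K$ fixed. It is not required that $\theta_{0,i}=x_i^{T}\beta$ for some $\beta$, so every candidate model may be misspecified. Write $y=(y_1,\ldots,y_n)^{T}$, $\theta_0=(\theta_{0,1},\ldots,\theta_{0,n})^{T}$, $\mu=Ey$, $\epsilon=(\epsilon_1,\ldots,\epsilon_n)^T=y-\mu$, $\overline{\sigma}^{2}=\max_{1\le i\le n}\operatorname{var}(\epsilon_i)$. All quantities may depend on $n$. **Missing covariates and candidate models.** Let $X$ be the $n\times K$ covariate matrix with rows $x_i^{T}$. Some entries of $X$ are missing completely at random (whether an entry is missing is independent of all covariates, including itself). The covariates and the missingness pattern are treated as nonrandom (conditioned upon). Columns of $X$ (covariates) with the same missingness positions are collected into one group; there are $S-1$ groups, and $S$ is finite and fixed. There are $S$ candidate models. Model $1$ (complete-case model) uses all $K$ covariates and only the observations with no missing covariate. Each of the models $s=2,\ldots,S$ uses only the covariates of one of the $S-1$ groups, and all observations for which these covariates are observed. For model $s$, $\zeta_s\subseteq\{1,\ldots,K\}$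 is the set of column indices used, $k_s=|\zeta_s|$, $n_s$ is the number of observations used, $X^{(s)}$ is the corresponding $n_s\times k_s$ covariate matrix (assumed of full column rank), and $y^{(s)}$ is the corresponding response subvector. Let $\pi_s$ be the $k_s\times K$ matrix mapping $\beta$ to its subvector $\pi_s\beta=(\beta_k)_{k\in\zeta_s}$. Let $\tilde\beta^{(s)}$ be the maximum likelihood estimator of $\pi_s\beta$ in model $s$ (based on $y^{(s)},X^{(s)}$), and $\hat\beta_{(s)}=\pi_s^{T}\tilde\beta^{(s)}\in\mathbb{R}^K$ (zeros outside $\zeta_s$). Let $\beta^*_{(s)}\in\mathbb{R}^K$ (also zero outside $\zeta_s$) be the parameter vector minimizing the Kullback-Leibler divergence between the true model and the $s$-th candidate model. **Averaging.** $\mathscr{W}=\{w=(w_1,\ldots,w_S)^T\in[0,1]^S:\sum_{s=1}^S w_s=1\}$. For $w\in\mathscr{W}$ put $\hat\beta(w)=\sum_{s=1}^S w_s\hat\beta_{(s)}$ and $\beta^*(w)=\sum_{s=1}^S w_s\beta^*_{(s)}$. Let $\tilde X$ be the $n\times K$ matrix obtained from $X$ by replacing missing entries by $0$ (assumed of full column rank). For $\beta\in\mathbb{R}^K$ put $\theta(\beta)=(\theta_1(\beta),\ldots,\theta_n(\beta))^{T}=\tilde X\beta$ and $B(\beta)=\sum_{i=1}^n b(\theta_i(\beta))$; also $B_0=\sum_{i=1}^n b(\theta_{0,i})$. The model averaging estimator of $\theta_0$ is $\theta\{\hat\beta(w)\}=\tilde X\hat\beta(w)$. "Between $\hat\beta(w)$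 and $\beta^*(w)$" means on the line segment joining them. **Losses and criterion.** The Kullback-Leibler loss of $\theta\{\hat\beta(w)\}$ is $$KL(w)=2\sum_{i=1}^nE_{y^*}\big\{\log f(y_i^*|\theta_{0,i},\phi)-\log f(y_i^*|\theta_i\{\hat\beta(w)\},\phi)\big\}=2\phi^{-1}B\{\hat\beta(w)\}-2\phi^{-1}\mu^{T}\theta\{\hat\beta(w)\}-2\phi^{-1}B_0+2\phi^{-1}\mu^{T}\theta_0,$$ where $y^*$ is another realization from $f(\cdot|\theta_0,\phi)$ independent of $y$. Further, $$KL^*(w)=2\phi^{-1}B\{\beta^*(w)\}-2\phi^{-1}B_0-2\phi^{-1}\mu^{T}[\theta\{\beta^*(w)\}-\theta_0],\qquad \xi_n=\inf_{w\in\mathscr{W}}KL^*(w).$$ The weight choice criterion is $$\mathscr{G}(w)=2\phi^{-1}B\{\hat\beta(w)\}-2\phi^{-1}y^{T}\theta\{\hat\beta(w)\}+\lambda_n w^{T}k,\qquad k=(k_1,\ldots,k_S)^{T},$$ where $\lambda_n$ is the penalty coefficient (a deterministic sequence). *)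

theory Defs
  imports "HOL-Probability.Probability" "HOL-Library.Landau_Symbols"
begin

subsection \<open>Stochastic order symbols\<close>

text \<open>
  Estimators and selected weights are arg max/arg min selections, for which no measurability is
  postulated.  Probabilities of events are therefore taken in the sense of the outer measure, which
  is the ordinary probability whenever the event is measurable.  (For a non-measurable set,
  \<^const>\<open>measure\<close> and \<^const>\<open>emeasure\<close> would return 0.)
\<close>

definition Op_unif ::
  "(nat \<Rightarrow> 'a measure) \<Rightarrow> 'w set \<Rightarrow> (nat \<Rightarrow> 'w \<Rightarrow> 'a \<Rightarrow> real) \<Rightarrow> (nat \<Rightarrow> real) \<Rightarrow> bool" where
  "Op_unif M W Z r \<longleftrightarrow>
     (\<forall>e>0. \<exists>C. \<forall>\<^sub>F n in sequentially.
        outer_measure_of (M n) {\<omega> \<in> space (M n). \<exists>w\<in>W. \<bar>Z n w \<omega>\<bar> > C * r n} \<le> ennreal e)"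

definition Op :: "(nat \<Rightarrow> 'a measure) \<Rightarrow> (nat \<Rightarrow> 'a \<Rightarrow> real) \<Rightarrow> (nat \<Rightarrow> real) \<Rightarrow> bool" where
  "Op M Z r \<longleftrightarrow>
     (\<forall>e>0. \<exists>C. \<forall>\<^sub>F n in sequentially.
        outer_measure_of (M n) {\<omega> \<in> space (M n). \<bar>Z n \<omega>\<bar> > C * r n} \<le> ennreal e)"

definition tendsto_in_prob :: "(nat \<Rightarrow> 'a measure) \<Rightarrow> (nat \<Rightarrow> 'a \<Rightarrow> real) \<Rightarrow> real \<Rightarrow> bool" where
  "tendsto_in_prob M Z l \<longleftrightarrow>
     (\<forall>\<delta>>0. (\<lambda>n. outer_measure_of (M n) {\<omega> \<in> space (M n). \<bar>Z n \<omega> - l\<bar> > \<delta>}) \<longlonglongrightarrow> 0)"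


subsection \<open>The exponential family\<close>

definition expfam :: "(real \<Rightarrow> real) \<Rightarrow> (real \<Rightarrow> real \<Rightarrow> real) \<Rightarrow> real \<Rightarrow> real \<Rightarrow> real \<Rightarrow> real" where
  "expfam b c \<phi> \<theta> y = exp ((y * \<theta> - b \<theta>) / \<phi> + c y \<phi>)"

text \<open>
  The densities are taken with respect to an arbitrary Borel measure \<open>\<nu>\<close>.  This covers Lebesgue
  densities, probability mass functions (\<open>\<nu>\<close> the counting measure of a countable set, viewed as a
  Borel measure), and families supported on a proper subset of the line (\<open>\<nu>\<close> a restriction); the
  latter is needed because \<^const>\<open>expfam\<close> is strictly positive.  As \<open>\<beta>\<close> ranges over all of
  \<open>\<real>^K\<close>, every real number is an admissible canonical parameter.
\<close>

definition exponential_family ::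
  "real measure \<Rightarrow> (real \<Rightarrow> real) \<Rightarrow> (real \<Rightarrow> real \<Rightarrow> real) \<Rightarrow> real \<Rightarrow> bool" where
  "exponential_family \<nu> b c \<phi> \<longleftrightarrow>
     sets \<nu> = sets borel \<and> \<phi> \<noteq> 0 \<and>
     (\<forall>\<theta>. expfam b c \<phi> \<theta> \<in> borel_measurable borel \<and>
          prob_space (density \<nu> (\<lambda>y. ennreal (expfam b c \<phi> \<theta> y))))"

text \<open>\<open>E\<^bsub>y*\<^esub> {log f(y*|\<theta>0) - log f(y*|\<theta>)}\<close>, with \<open>y*\<close> distributed according to \<open>f(.|\<theta>0)\<close>.\<close>

definition KL_div ::
  "real measure \<Rightarrow> (real \<Rightarrow> real) \<Rightarrow> (real \<Rightarrow> real \<Rightarrow> real) \<Rightarrow> real \<Rightarrow> real \<Rightarrow> real \<Rightarrow> real" where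
  "KL_div \<nu> b c \<phi> \<theta>0 \<theta> =
     (\<integral>y. (ln (expfam b c \<phi> \<theta>0 y) - ln (expfam b c \<phi> \<theta> y))
        \<partial>density \<nu> (\<lambda>y. ennreal (expfam b c \<phi> \<theta>0 y)))"


subsection \<open>Missing covariates and candidate models\<close>

text \<open>
  For a fixed sample size \<open>n\<close>, observations are indexed by \<open>{1..n}\<close> and covariates by the finite type
  \<open>'k\<close>, so \<open>K = CARD('k)\<close>.  \<open>X i\<close> is the \<open>i\<close>-th row of the covariate matrix, and \<open>mis i j\<close> states
  that its \<open>j\<close>-th entry is missing.  A vector of \<open>\<real>^(k_s)\<close> is identified with its zero-padding in
  \<open>\<real>^K\<close>, that is, with a vector supported on \<open>\<zeta>_s\<close>.
\<close>

definition missing_positions :: "(nat \<Rightarrow> 'k \<Rightarrow> bool) \<Rightarrow> nat \<Rightarrow> 'k \<Rightarrow> nat set" where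
  "missing_positions mis n j = {i \<in> {1..n}. mis i j}"

definition covariate_groups :: "(nat \<Rightarrow> 'k \<Rightarrow> bool) \<Rightarrow> nat \<Rightarrow> 'k set set" where
  "covariate_groups mis n =
     (\<lambda>j. {l. missing_positions mis n l = missing_positions mis n j}) ` UNIV"

definition candidate_models ::
  "(nat \<Rightarrow> 'k \<Rightarrow> bool) \<Rightarrow> nat \<Rightarrow> nat \<Rightarrow> (nat \<Rightarrow> 'k set) \<Rightarrow> bool" where
  "candidate_models mis n S \<zeta> \<longleftrightarrow>
     \<zeta> 1 = UNIV \<and> bij_betw \<zeta> {2..S} (covariate_groups mis n)"

definition used_obs :: "(nat \<Rightarrow> 'k \<Rightarrow> bool) \<Rightarrow> nat \<Rightarrow> 'k set \<Rightarrow> nat set" where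
  "used_obs mis n Z = {i \<in> {1..n}. \<forall>j\<in>Z. \<not> mis i j}"

definition supported_on :: "'k set \<Rightarrow> real^'k \<Rightarrow> bool" where
  "supported_on Z \<beta> \<longleftrightarrow> (\<forall>j. j \<notin> Z \<longrightarrow> \<beta> $ j = 0)"

definition restrict_to :: "'k set \<Rightarrow> real^'k \<Rightarrow> real^'k" where
  "restrict_to Z x = (\<chi> j. if j \<in> Z then x $ j else 0)"

definition zero_fill :: "(nat \<Rightarrow> 'k \<Rightarrow> bool) \<Rightarrow> (nat \<Rightarrow> real^'k) \<Rightarrow> nat \<Rightarrow> real^'k" where
  "zero_fill mis X i = (\<chi> j. if mis i j then 0 else X i $ j)"

text \<open>
  Full column rank of the matrix with rows \<open>i \<in> I\<close> and columns \<open>j \<in> Z\<close>, the rank being the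
  dimension of the row space as in \<open>row_rank_def\<close>.
\<close>

definition full_column_rank :: "(nat \<Rightarrow> real^'k) \<Rightarrow> nat set \<Rightarrow> 'k set \<Rightarrow> bool" where
  "full_column_rank X I Z \<longleftrightarrow> dim ((\<lambda>i. restrict_to Z (X i)) ` I) = card Z"

definition is_MLE ::
  "(real \<Rightarrow> real) \<Rightarrow> (real \<Rightarrow> real \<Rightarrow> real) \<Rightarrow> real \<Rightarrow> (nat \<Rightarrow> real) \<Rightarrow> (nat \<Rightarrow> real^'k)
     \<Rightarrow> nat set \<Rightarrow> 'k set \<Rightarrow> real^'k \<Rightarrow> bool" where
  "is_MLE b c \<phi> y X I Z \<beta> \<longleftrightarrow>
     is_arg_max (\<lambda>\<beta>. \<Prod>i\<in>I. expfam b c \<phi> (X i \<bullet> \<beta>) (y i)) (supported_on Z) \<beta>"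

definition is_KL_minimizer ::
  "real measure \<Rightarrow> (real \<Rightarrow> real) \<Rightarrow> (real \<Rightarrow> real \<Rightarrow> real) \<Rightarrow> real \<Rightarrow> (nat \<Rightarrow> real)
     \<Rightarrow> (nat \<Rightarrow> real^'k) \<Rightarrow> nat set \<Rightarrow> 'k set \<Rightarrow> real^'k \<Rightarrow> bool" where
  "is_KL_minimizer \<nu> b c \<phi> \<theta>0 X I Z \<beta> \<longleftrightarrow>
     is_arg_min (\<lambda>\<beta>. \<Sum>i\<in>I. KL_div \<nu> b c \<phi> (\<theta>0 i) (X i \<bullet> \<beta>)) (supported_on Z) \<beta>"


subsection \<open>Averaging, losses and criterion\<close>

text \<open>
  \<open>Xt\<close> stands for the rows of the zero-filled covariate matrix, so \<open>Xt i \<bullet> \<beta>\<close> is \<open>\<theta>_i(\<beta>)\<close>.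
\<close>

definition weights :: "nat \<Rightarrow> (nat \<Rightarrow> real) set" where
  "weights S = {w. (\<forall>s\<in>{1..S}. w s \<in> {0..1}) \<and> (\<Sum>s=1..S. w s) = 1}"

definition avg :: "nat \<Rightarrow> (nat \<Rightarrow> real) \<Rightarrow> (nat \<Rightarrow> real^'k) \<Rightarrow> real^'k" where
  "avg S w \<beta> = (\<Sum>s=1..S. w s *\<^sub>R \<beta> s)"

definition Bsum :: "(real \<Rightarrow> real) \<Rightarrow> nat \<Rightarrow> (nat \<Rightarrow> real^'k) \<Rightarrow> real^'k \<Rightarrow> real" where
  "Bsum b n Xt \<beta> = (\<Sum>i=1..n. b (Xt i \<bullet> \<beta>))"

definition gradient :: "(real^'k \<Rightarrow> real) \<Rightarrow> real^'k \<Rightarrow> real^'k" where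
  "gradient F \<beta> = (\<chi> j. frechet_derivative F (at \<beta>) (axis j 1))"

definition KL_loss ::
  "real measure \<Rightarrow> (real \<Rightarrow> real) \<Rightarrow> (real \<Rightarrow> real \<Rightarrow> real) \<Rightarrow> real \<Rightarrow> nat \<Rightarrow> (nat \<Rightarrow> real)
     \<Rightarrow> (nat \<Rightarrow> real^'k) \<Rightarrow> real^'k \<Rightarrow> real" where
  "KL_loss \<nu> b c \<phi> n \<theta>0 Xt \<beta> = 2 * (\<Sum>i=1..n. KL_div \<nu> b c \<phi> (\<theta>0 i) (Xt i \<bullet> \<beta>))"

definition KL_star ::
  "(real \<Rightarrow> real) \<Rightarrow> real \<Rightarrow> nat \<Rightarrow> (nat \<Rightarrow> real) \<Rightarrow> (nat \<Rightarrow> real) \<Rightarrow> (nat \<Rightarrow> real^'k) \<Rightarrow> real^'k \<Rightarrow> real"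
  where
  "KL_star b \<phi> n \<theta>0 \<mu> Xt \<beta> =
     2 / \<phi> * Bsum b n Xt \<beta> - 2 / \<phi> * (\<Sum>i=1..n. b (\<theta>0 i))
     - 2 / \<phi> * (\<Sum>i=1..n. \<mu> i * (Xt i \<bullet> \<beta> - \<theta>0 i))"

definition criterion ::
  "(real \<Rightarrow> real) \<Rightarrow> real \<Rightarrow> nat \<Rightarrow> (nat \<Rightarrow> real) \<Rightarrow> (nat \<Rightarrow> real^'k) \<Rightarrow> real^'k \<Rightarrow> real \<Rightarrow> real" where
  "criterion b \<phi> n y Xt \<beta> pen =
     2 / \<phi> * Bsum b n Xt \<beta> - 2 / \<phi> * (\<Sum>i=1..n. y i * (Xt i \<bullet> \<beta>)) + pen"

end

theory Submission
  imports Defs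
begin

text \<open>
  The criterion \<open>G\<close> is an empirical version of the Kullback-Leibler loss: up to a term \<open>\<kappa>\<close> free of
  the weights, \<open>G - KL\<close> consists of the noise term \<open>(2 / \<phi>) * \<epsilon>\<^sup>T \<theta>(\<beta>hat(w))\<close> (with a minus sign) and
  the penalty.  The idea is to show that both \<open>G - KL - \<kappa>\<close> and \<open>KL - KLstar\<close> are of order
  \<open>O\<^sub>p(n\<^bsup>1/2\<^esup>)\<close> uniformly in the weights, whereas \<open>KLstar\<close> is at least \<open>\<xi>\<close>, which dominates
  \<open>n\<^bsup>1/2\<^esup>\<close> because \<open>n / \<xi>\<^sup>2\<close> tends to 0.  On an event where both errors are at most \<open>a * \<xi>\<close>, minimizing \<open>G\<close>
  comes within \<open>2 * a * \<xi>\<close> of minimizing \<open>KL\<close>, and the infimum of \<open>KL\<close> is at least \<open>(1 - a) * \<xi>\<close>,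
  so that the ratio differs from 1 by at most \<open>2 * a / (1 - a)\<close> (lemma \<open>argmin_loss_ratio\<close>).

  The rates arise as follows.  As the weights are a convex combination, \<open>\<beta>hat(w) - \<beta>star(w)\<close> is
  bounded by the sum of the finitely many estimation errors, thus \<open>O\<^sub>p(n\<^bsup>-1/2\<^esup>)\<close> uniformly in \<open>w\<close>.
  The mean value theorem (\<open>gradient_mean_value\<close>) and the gradient bound \<open>O\<^sub>p(n)\<close> give the increment
  of \<open>B\<close>; the remaining linear part of \<open>KL - KLstar\<close> is handled by the Cauchy-Schwarz inequality.
  The noise term is split at \<open>\<beta>star(w)\<close>: the part along \<open>\<beta>hat(w) - \<beta>star(w)\<close> is again a
  Cauchy-Schwarz bound, and the part along \<open>\<beta>star(w)\<close> is a convex combination of \<open>S\<close> weighted sums of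
  independent errors with variances of order \<open>n\<close> (\<open>Op_weighted_sum_indep\<close>).

  Three facts about the family enter, all drawn from the identity
  \<open>E exp (h * y) = exp ((b (\<theta> + \<phi> * h) - b \<theta>) / \<phi>)\<close> that the normalization of the densities yields:
  responses have finite second moments, \<open>b\<close> is differentiable with derivative the mean of the
  response, and the Kullback-Leibler divergence is an explicit function of \<open>b\<close> and the
  mean response, and is non-negative.  By the
  last one \<open>KLstar\<close> is bounded below, so that \<open>\<xi>\<close> is a lower bound of it, and \<open>\<xi>\<close>, being
  non-negative and eventually nonzero, is eventually positive.
\<close>

section \<open>Calculus of uniform stochastic order symbols\<close>

lemma outer_measure_of_Un_le:
  assumes "A \<subseteq> space M" "B \<subseteq> space M"
  shows "outer_measure_of M (A \<union> B) \<le> outer_measure_of M A + outer_measure_of M B"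
proof -
  obtain A' where A': "A' \<in> sets M" "A \<subseteq> A'" "outer_measure_of M A = emeasure M A'"
    using outer_measure_of_attain[OF assms(1)] by auto
  obtain B' where B': "B' \<in> sets M" "B \<subseteq> B'" "outer_measure_of M B = emeasure M B'"
    using outer_measure_of_attain[OF assms(2)] by auto
  have "outer_measure_of M (A \<union> B) \<le> outer_measure_of M (A' \<union> B')"
    using A' B' by (intro outer_measure_of_mono) auto
  also have "\<dots> \<le> emeasure M A' + emeasure M B'"
    using A' B' by (simp add: emeasure_subadditive)
  finally show ?thesis
    using A' B' by simp
qed

text \<open>
  All closure properties of \<open>O\<^sub>p\<close> come from this one fact: a bound for \<open>Z\<close> that holds pointwise
  wherever \<open>Z1\<close> and \<open>Z2\<close> are within their rates can fail only on the union of two sets of outer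
  measure at most \<open>e / 2\<close>.  Uniformity in the index costs nothing, as the exceptional sets already
  collect the bad sample points of all indices.
\<close>

lemma Op_unif_combine:
  assumes Z1: "Op_unif M W Z1 r1" and Z2: "Op_unif M W Z2 r2"
    and bound: "\<And>C1 C2. \<exists>C. \<forall>\<^sub>F n in sequentially. \<forall>\<omega>\<in>space (M n). \<forall>w\<in>W.
      \<bar>Z1 n w \<omega>\<bar> \<le> C1 * r1 n \<longrightarrow> \<bar>Z2 n w \<omega>\<bar> \<le> C2 * r2 n \<longrightarrow> \<bar>Z n w \<omega>\<bar> \<le> C * r n"
  shows "Op_unif M W Z r"
  unfolding Op_unif_def
proof (intro allI impI)
  fix e :: real assume "e > 0"
  then have "e / 2 > 0" by simp
  then obtain C1 C2 where
    1: "\<forall>\<^sub>F n in sequentially.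
        outer_measure_of (M n) {\<omega> \<in> space (M n). \<exists>w\<in>W. \<bar>Z1 n w \<omega>\<bar> > C1 * r1 n} \<le> ennreal (e / 2)"
    and 2: "\<forall>\<^sub>F n in sequentially.
        outer_measure_of (M n) {\<omega> \<in> space (M n). \<exists>w\<in>W. \<bar>Z2 n w \<omega>\<bar> > C2 * r2 n} \<le> ennreal (e / 2)"
    using Z1 Z2 unfolding Op_unif_def by blast
  obtain C where 3: "\<forall>\<^sub>F n in sequentially. \<forall>\<omega>\<in>space (M n). \<forall>w\<in>W.
      \<bar>Z1 n w \<omega>\<bar> \<le> C1 * r1 n \<longrightarrow> \<bar>Z2 n w \<omega>\<bar> \<le> C2 * r2 n \<longrightarrow> \<bar>Z n w \<omega>\<bar> \<le> C * r n"
    using bound by blast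
  have "\<forall>\<^sub>F n in sequentially.
      outer_measure_of (M n) {\<omega> \<in> space (M n). \<exists>w\<in>W. \<bar>Z n w \<omega>\<bar> > C * r n} \<le> ennreal e"
    using 1 2 3
  proof eventually_elim
    case (elim n)
    let ?A1 = "{\<omega> \<in> space (M n). \<exists>w\<in>W. \<bar>Z1 n w \<omega>\<bar> > C1 * r1 n}"
    let ?A2 = "{\<omega> \<in> space (M n). \<exists>w\<in>W. \<bar>Z2 n w \<omega>\<bar> > C2 * r2 n}"
    have "outer_measure_of (M n) {\<omega> \<in> space (M n). \<exists>w\<in>W. \<bar>Z n w \<omega>\<bar> > C * r n}
        \<le> outer_measure_of (M n) (?A1 \<union> ?A2)"
      using elim(3) by (intro outer_measure_of_mono) (fastforce simp: not_less[symmetric])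
    also have "\<dots> \<le> outer_measure_of (M n) ?A1 + outer_measure_of (M n) ?A2"
      by (rule outer_measure_of_Un_le) auto
    also have "\<dots> \<le> ennreal (e / 2) + ennreal (e / 2)"
      using elim by (intro add_mono) auto
    also have "\<dots> = ennreal e"
      using \<open>e > 0\<close> by (simp flip: ennreal_plus)
    finally show ?case .
  qed
  then show "\<exists>C. \<forall>\<^sub>F n in sequentially.
      outer_measure_of (M n) {\<omega> \<in> space (M n). \<exists>w\<in>W. \<bar>Z n w \<omega>\<bar> > C * r n} \<le> ennreal e"
    by blast
qed

lemma Op_unif_add:
  assumes "Op_unif M W Z1 r" "Op_unif M W Z2 r"
  shows "Op_unif M W (\<lambda>n w \<omega>. Z1 n w \<omega> + Z2 n w \<omega>) r"
proof (rule Op_unif_combine[OF assms])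
  fix C1 C2
  show "\<exists>C. \<forall>\<^sub>F n in sequentially. \<forall>\<omega>\<in>space (M n). \<forall>w\<in>W.
      \<bar>Z1 n w \<omega>\<bar> \<le> C1 * r n \<longrightarrow> \<bar>Z2 n w \<omega>\<bar> \<le> C2 * r n \<longrightarrow> \<bar>Z1 n w \<omega> + Z2 n w \<omega>\<bar> \<le> C * r n"
    by (rule exI[of _ "C1 + C2"], rule always_eventually) (auto simp: ring_distribs)
qed

lemma Op_unif_mult:
  assumes "Op_unif M W Z1 r1" "Op_unif M W Z2 r2"
  shows "Op_unif M W (\<lambda>n w \<omega>. Z1 n w \<omega> * Z2 n w \<omega>) (\<lambda>n. r1 n * r2 n)"
proof (rule Op_unif_combine[OF assms])
  fix C1 C2
  have "\<bar>x * y\<bar> \<le> C1 * C2 * (r1 n * r2 n)" if "\<bar>x\<bar> \<le> C1 * r1 n" "\<bar>y\<bar> \<le> C2 * r2 n" for n x y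
  proof -
    have "\<bar>x\<bar> * \<bar>y\<bar> \<le> (C1 * r1 n) * (C2 * r2 n)"
      using that by (intro mult_mono) auto
    then show ?thesis by (simp add: abs_mult ac_simps)
  qed
  then show "\<exists>C. \<forall>\<^sub>F n in sequentially. \<forall>\<omega>\<in>space (M n). \<forall>w\<in>W.
      \<bar>Z1 n w \<omega>\<bar> \<le> C1 * r1 n \<longrightarrow> \<bar>Z2 n w \<omega>\<bar> \<le> C2 * r2 n \<longrightarrow>
      \<bar>Z1 n w \<omega> * Z2 n w \<omega>\<bar> \<le> C * (r1 n * r2 n)"
    by (intro exI[of _ "C1 * C2"] always_eventually) blast
qed

lemma Op_unif_mono:
  assumes "Op_unif M W Z1 r"
    and "\<forall>\<^sub>F n in sequentially. \<forall>\<omega>\<in>space (M n). \<forall>w\<in>W. \<bar>Z2 n w \<omega>\<bar> \<le> \<bar>Z1 n w \<omega>\<bar>"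
  shows "Op_unif M W Z2 r"
proof (rule Op_unif_combine[OF assms(1) assms(1)])
  fix C1 C2
  show "\<exists>C. \<forall>\<^sub>F n in sequentially. \<forall>\<omega>\<in>space (M n). \<forall>w\<in>W.
      \<bar>Z1 n w \<omega>\<bar> \<le> C1 * r n \<longrightarrow> \<bar>Z1 n w \<omega>\<bar> \<le> C2 * r n \<longrightarrow> \<bar>Z2 n w \<omega>\<bar> \<le> C * r n"
    using assms(2) by (intro exI[of _ C1]) (auto elim!: eventually_mono intro: order_trans)
qed

lemma Op_unif_bigo:
  assumes "Op_unif M W Z r" "r \<in> O(r')" "\<And>n. r' n \<ge> 0"
  shows "Op_unif M W Z r'"
proof (rule Op_unif_combine[OF assms(1) assms(1)])
  fix C1 C2
  obtain c where c: "\<forall>\<^sub>F n in sequentially. norm (r n) \<le> c * norm (r' n)"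
    using assms(2) by (rule landau_o.bigE)
  have "C1 * x \<le> \<bar>C1\<bar> * c * r' n" if "norm x \<le> c * norm (r' n)" for n x
  proof -
    have "C1 * x \<le> \<bar>C1\<bar> * \<bar>x\<bar>" by (metis abs_ge_self abs_mult)
    also have "\<dots> \<le> \<bar>C1\<bar> * (c * r' n)"
      using that assms(3)[of n] by (intro mult_left_mono) auto
    finally show ?thesis by simp
  qed
  with c show "\<exists>C. \<forall>\<^sub>F n in sequentially. \<forall>\<omega>\<in>space (M n). \<forall>w\<in>W.
      \<bar>Z n w \<omega>\<bar> \<le> C1 * r n \<longrightarrow> \<bar>Z n w \<omega>\<bar> \<le> C2 * r n \<longrightarrow> \<bar>Z n w \<omega>\<bar> \<le> C * r' n"
    by (intro exI[of _ "\<bar>C1\<bar> * c"]) (auto elim!: eventually_mono intro: order_trans)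
qed

lemma Op_unif_deterministic:
  assumes "f \<in> O(r)" "\<And>n. r n \<ge> 0"
  shows "Op_unif M W (\<lambda>n w \<omega>. f n) r"
  unfolding Op_unif_def
proof (intro allI impI)
  fix e :: real assume "e > 0"
  obtain C where "\<forall>\<^sub>F n in sequentially. norm (f n) \<le> C * norm (r n)"
    using assms(1) by (rule landau_o.bigE)
  then have "\<forall>\<^sub>F n in sequentially.
      outer_measure_of (M n) {\<omega> \<in> space (M n). \<exists>w\<in>W. \<bar>f n\<bar> > C * r n} \<le> ennreal e"
  proof eventually_elim
    case (elim n)
    then have "{\<omega> \<in> space (M n). \<exists>w\<in>W. \<bar>f n\<bar> > C * r n} = {}"
      using assms(2)[of n] by auto
    then show ?case by (simp only: outer_measure_of_eq sets.empty_sets emeasure_empty zero_le)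
  qed
  then show "\<exists>C. \<forall>\<^sub>F n in sequentially.
      outer_measure_of (M n) {\<omega> \<in> space (M n). \<exists>w\<in>W. \<bar>f n\<bar> > C * r n} \<le> ennreal e"
    by blast
qed

lemma Op_unif_cmult:
  assumes "Op_unif M W Z r"
  shows "Op_unif M W (\<lambda>n w \<omega>. c * Z n w \<omega>) r"
  using Op_unif_mult[OF Op_unif_deterministic[of "\<lambda>_. c" "\<lambda>_. 1"] assms] by simp

lemma Op_unif_sum:
  assumes "finite I" "\<And>s. s \<in> I \<Longrightarrow> Op_unif M W (Z s) r" "\<And>n. r n \<ge> 0"
  shows "Op_unif M W (\<lambda>n w \<omega>. \<Sum>s\<in>I. Z s n w \<omega>) r"
  using assms
proof (induction I rule: finite_induct)
  case empty
  then show ?case using Op_unif_deterministic[of "\<lambda>_. 0" r] by simp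
next
  case (insert s I)
  then show ?case using Op_unif_add[of M W "Z s" r] by simp
qed

lemma Op_unif_const_index:
  assumes "Op M Z r"
  shows "Op_unif M W (\<lambda>n w. Z n) r"
  unfolding Op_unif_def
proof (intro allI impI)
  fix e :: real assume "e > 0"
  then obtain C where C: "\<forall>\<^sub>F n in sequentially.
      outer_measure_of (M n) {\<omega> \<in> space (M n). \<bar>Z n \<omega>\<bar> > C * r n} \<le> ennreal e"
    using assms unfolding Op_def by blast
  have "\<forall>\<^sub>F n in sequentially.
      outer_measure_of (M n) {\<omega> \<in> space (M n). \<exists>w\<in>W. \<bar>Z n \<omega>\<bar> > C * r n} \<le> ennreal e"
    using C by eventually_elim (rule order_trans[OF outer_measure_of_mono], auto)
  then show "\<exists>C. \<forall>\<^sub>F n in sequentially.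
      outer_measure_of (M n) {\<omega> \<in> space (M n). \<exists>w\<in>W. \<bar>Z n \<omega>\<bar> > C * r n} \<le> ennreal e"
    by blast
qed

text \<open>
  The form in which the rates are used: an error of order \<open>O\<^sub>p(r)\<close> with \<open>r = o(\<xi>)\<close> is eventually
  below every fixed fraction \<open>a\<close> of \<open>\<xi>\<close>, outside events whose probability vanishes.
\<close>

lemma Op_unif_smallo_exceedance:
  assumes Z: "Op_unif M W Z r" and r: "r \<in> o(\<xi>)" "\<And>n. r n \<ge> 0"
    and \<xi>: "\<forall>\<^sub>F n in sequentially. \<xi> n > 0" and a: "a > 0"
  shows "(\<lambda>n. outer_measure_of (M n) {\<omega> \<in> space (M n). \<exists>w\<in>W. \<bar>Z n w \<omega>\<bar> > a * \<xi> n}) \<longlonglongrightarrow> 0"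
proof (rule order_tendstoI)
  fix e :: ennreal assume "0 < e"
  then obtain e' where e': "0 < e'" "e' < e" using dense by blast
  \<comment> \<open>the definition of the order symbol takes real tolerances, while the limit is one of extended reals\<close>
  define d where "d = enn2real e'"
  have e'_fin: "e' < \<top>" using e' by (meson less_top_ennreal order_less_le_trans top_greatest)
  have d: "d > 0" "ennreal d < e"
    using e' e'_fin by (auto simp: d_def enn2real_positive_iff less_top)
  obtain C where C: "\<forall>\<^sub>F n in sequentially.
      outer_measure_of (M n) {\<omega> \<in> space (M n). \<exists>w\<in>W. \<bar>Z n w \<omega>\<bar> > C * r n} \<le> ennreal d"
    using Z d(1) unfolding Op_unif_def by blast
  have "a / (\<bar>C\<bar> + 1) > 0" using a by simp
  then have "\<forall>\<^sub>F n in sequentially. norm (r n) \<le> a / (\<bar>C\<bar> + 1) * norm (\<xi> n)"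
    using r(1) by (rule landau_o.smallD[rotated])
  with \<xi> C show "\<forall>\<^sub>F n in sequentially.
      outer_measure_of (M n) {\<omega> \<in> space (M n). \<exists>w\<in>W. \<bar>Z n w \<omega>\<bar> > a * \<xi> n} < e"
  proof eventually_elim
    case (elim n)
    have "C * r n \<le> (\<bar>C\<bar> + 1) * r n"
      using r(2) by (intro mult_right_mono) auto
    also have "\<dots> \<le> a * \<xi> n"
      using elim(1,3) r(2)[of n] by (simp add: field_simps)
    finally have "outer_measure_of (M n) {\<omega> \<in> space (M n). \<exists>w\<in>W. \<bar>Z n w \<omega>\<bar> > a * \<xi> n}
        \<le> outer_measure_of (M n) {\<omega> \<in> space (M n). \<exists>w\<in>W. \<bar>Z n w \<omega>\<bar> > C * r n}"
      by (intro outer_measure_of_mono) force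
    with elim(2) d(2) show ?case by (meson order_le_less_trans order_trans)
  qed
qed simp

text \<open>
Markov's inequality for the square gives probabilities of order \<open>1 / D\<^sup>2\<close> for exceeding \<open>D\<close> times the rate.
\<close>

lemma Op_second_moment:
  assumes "\<forall>\<^sub>F n in sequentially. integrable (M n) (\<lambda>\<omega>. (Z n \<omega>)\<^sup>2) \<and>
      Z n \<in> borel_measurable (M n) \<and> (\<integral>\<omega>. (Z n \<omega>)\<^sup>2 \<partial>M n) \<le> C * (r n)\<^sup>2 \<and> r n > 0"
  shows "Op M Z r"
  unfolding Op_def
proof (intro allI impI)
  fix e :: real assume e: "e > 0"
  define D where "D = sqrt ((\<bar>C\<bar> + 1) / e)"
  \<comment> \<open>chosen so that the Markov bound \<open>C / D\<^sup>2\<close> is at most \<open>e\<close>; the summand 1 keeps \<open>D\<close> positive\<close>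
  have D: "D > 0" "D\<^sup>2 = (\<bar>C\<bar> + 1) / e" using e by (auto simp: D_def add_nonneg_pos)
  have "\<forall>\<^sub>F n in sequentially.
      outer_measure_of (M n) {\<omega> \<in> space (M n). \<bar>Z n \<omega>\<bar> > D * r n} \<le> ennreal e"
    using assms
  proof eventually_elim
    case (elim n)
    then have [measurable]: "Z n \<in> borel_measurable (M n)" and r: "r n > 0" by auto
    have pos: "(D * r n)\<^sup>2 > 0" using D r by simp
    have "{\<omega> \<in> space (M n). \<bar>Z n \<omega>\<bar> > D * r n} \<subseteq> {\<omega> \<in> space (M n). (Z n \<omega>)\<^sup>2 \<ge> (D * r n)\<^sup>2}"
      using D r by (auto simp: abs_le_square_iff[symmetric])
    then have "outer_measure_of (M n) {\<omega> \<in> space (M n). \<bar>Z n \<omega>\<bar> > D * r n}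
        \<le> outer_measure_of (M n) {\<omega> \<in> space (M n). (Z n \<omega>)\<^sup>2 \<ge> (D * r n)\<^sup>2}"
      by (rule outer_measure_of_mono)
    also have "\<dots> = emeasure (M n) {\<omega> \<in> space (M n). (Z n \<omega>)\<^sup>2 \<ge> (D * r n)\<^sup>2}"
      by simp
    also have "\<dots> \<le> ennreal (1 / (D * r n)\<^sup>2 * (\<integral>\<omega>. (Z n \<omega>)\<^sup>2 \<partial>M n))"
      using integral_Markov_inequality[of "M n" "\<lambda>\<omega>. (Z n \<omega>)\<^sup>2" "(D * r n)\<^sup>2"] elim pos
      by auto
    also have "\<dots> \<le> ennreal e"
    proof (rule ennreal_leI)
      have "1 / (D * r n)\<^sup>2 * (\<integral>\<omega>. (Z n \<omega>)\<^sup>2 \<partial>M n) \<le> 1 / (D * r n)\<^sup>2 * (C * (r n)\<^sup>2)"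
        using elim by (intro mult_left_mono) auto
      also have "\<dots> = C * e / (\<bar>C\<bar> + 1)"
        using r D e by (simp add: power_mult_distrib)
      also have "\<dots> \<le> e"
      proof -
        have "C * e \<le> (\<bar>C\<bar> + 1) * e"
          using e by (intro mult_right_mono) auto
        then show ?thesis by (simp add: field_simps)
      qed
      finally show "1 / (D * r n)\<^sup>2 * (\<integral>\<omega>. (Z n \<omega>)\<^sup>2 \<partial>M n) \<le> e" .
    qed
    finally show ?case .
  qed
  then show "\<exists>C. \<forall>\<^sub>F n in sequentially.
      outer_measure_of (M n) {\<omega> \<in> space (M n). \<bar>Z n \<omega>\<bar> > C * r n} \<le> ennreal e"
    by blast
qed

section \<open>Moments and divergence of an exponential family\<close>

text \<open>
  A second-order Taylor bound whose right-hand side depends on \<open>t\<close> through an integrable function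
  only; integrating it differentiates the moment generating function under the integral sign.
\<close>

lemma exp_remainder_bound:
  fixes h t :: real
  assumes "\<bar>h\<bar> \<le> 1"
  shows "\<bar>exp (h * t) - 1 - h * t\<bar> \<le> h\<^sup>2 * exp (2 * \<bar>t\<bar>)"
proof -
  obtain u where u: "\<bar>u\<bar> \<le> \<bar>h * t\<bar>" "exp (h * t) = (\<Sum>m<2. (h * t) ^ m / fact m) + exp u / fact 2 * (h * t)\<^sup>2"
    using Maclaurin_exp_le[of "h * t" 2] by blast
  have "\<bar>h * t\<bar> \<le> 1 * \<bar>t\<bar>"
    unfolding abs_mult using assms by (intro mult_right_mono) auto
  then have "exp u \<le> exp \<bar>t\<bar>" using u(1) by simp
  moreover have "t\<^sup>2 / 2 \<le> exp \<bar>t\<bar>"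
    using exp_lower_Taylor_quadratic[of "\<bar>t\<bar>"] by simp
  ultimately have "exp u * (t\<^sup>2 / 2) \<le> exp \<bar>t\<bar> * exp \<bar>t\<bar>"
    by (intro mult_mono) auto
  then have "h\<^sup>2 * (exp u * (t\<^sup>2 / 2)) \<le> h\<^sup>2 * exp (2 * \<bar>t\<bar>)"
    by (intro mult_left_mono) (auto simp flip: exp_add)
  moreover have "exp (h * t) - 1 - h * t = h\<^sup>2 * (exp u * (t\<^sup>2 / 2))"
    using u(2) by (simp add: numeral_2_eq_2 power2_eq_square)
  moreover have "0 \<le> h\<^sup>2 * (exp u * (t\<^sup>2 / 2))" by simp
  ultimately show ?thesis by linarith
qed

locale exp_family =
  fixes \<nu> :: "real measure" and b :: "real \<Rightarrow> real" and c :: "real \<Rightarrow> real \<Rightarrow> real" and \<phi> :: real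
  assumes family: "exponential_family \<nu> b c \<phi>"
begin

definition law :: "real \<Rightarrow> real measure" where
  "law \<theta> = density \<nu> (\<lambda>t. ennreal (expfam b c \<phi> \<theta> t))"

definition mean :: "real \<Rightarrow> real" where
  "mean \<theta> = (\<integral>t. t \<partial>law \<theta>)"

lemma \<phi>_nonzero: "\<phi> \<noteq> 0" and sets_\<nu> [measurable_cong]: "sets \<nu> = sets borel"
  and expfam_measurable [measurable]: "expfam b c \<phi> \<theta> \<in> borel_measurable borel"
  and prob_space_law: "prob_space (law \<theta>)"
  using family by (auto simp: exponential_family_def law_def)

lemma sets_law [measurable_cong, simp]: "sets (law \<theta>) = sets borel"
  by (simp add: law_def sets_\<nu>)

lemma expfam_nonneg [simp]: "expfam b c \<phi> \<theta> t \<ge> 0"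
  by (simp add: expfam_def)

lemma expfam_integrable: "integrable \<nu> (expfam b c \<phi> \<theta>)"
  and expfam_integral: "(\<integral>t. expfam b c \<phi> \<theta> t \<partial>\<nu>) = 1"
proof -
  have "(\<integral>\<^sup>+t. ennreal (expfam b c \<phi> \<theta> t) \<partial>\<nu>) = emeasure (law \<theta>) (space (law \<theta>))"
    by (simp add: law_def emeasure_density cong: nn_integral_cong)
  also have "\<dots> = ennreal 1"
    using prob_space.emeasure_space_1[OF prob_space_law] by simp
  finally have "has_bochner_integral \<nu> (expfam b c \<phi> \<theta>) 1"
    by (intro has_bochner_integral_nn_integral) auto
  then show "integrable \<nu> (expfam b c \<phi> \<theta>)" "(\<integral>t. expfam b c \<phi> \<theta> t \<partial>\<nu>) = 1"
    by (auto simp: has_bochner_integral_iff)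
qed

text \<open>
  The density at \<open>\<theta>\<close>, multiplied by an exponential, is up to a constant the density at a shifted
  parameter.  As every real parameter is admissible, all exponential moments are therefore finite and
  known in closed form.
\<close>

lemma expfam_tilt:
  "expfam b c \<phi> \<theta> t * exp (h * t) =
     exp ((b (\<theta> + \<phi> * h) - b \<theta>) / \<phi>) * expfam b c \<phi> (\<theta> + \<phi> * h) t"
  using \<phi>_nonzero by (simp add: expfam_def flip: exp_add) (simp add: field_simps)

lemma exp_integrable: "integrable (law \<theta>) (\<lambda>t. exp (h * t))"
  and mgf: "(\<integral>t. exp (h * t) \<partial>law \<theta>) = exp ((b (\<theta> + \<phi> * h) - b \<theta>) / \<phi>)"
proof -
  show "integrable (law \<theta>) (\<lambda>t. exp (h * t))"
    unfolding law_def using expfam_integrable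
    by (subst integrable_real_density) (auto simp: expfam_tilt)
  show "(\<integral>t. exp (h * t) \<partial>law \<theta>) = exp ((b (\<theta> + \<phi> * h) - b \<theta>) / \<phi>)"
    unfolding law_def using expfam_integral[of "\<theta> + \<phi> * h"]
    by (subst integral_real_density) (auto simp: expfam_tilt)
qed

lemma exp_abs_integrable: "integrable (law \<theta>) (\<lambda>t. exp (h * \<bar>t\<bar>))"
proof (rule Bochner_Integration.integrable_bound)
  show "integrable (law \<theta>) (\<lambda>t. exp (h * t) + exp (- h * t))"
    by (intro Bochner_Integration.integrable_add exp_integrable)
  show "AE t in law \<theta>. norm (exp (h * \<bar>t\<bar>)) \<le> norm (exp (h * t) + exp (- h * t))"
  proof (intro AE_I2)
    fix t :: real
    have "exp (h * \<bar>t\<bar>) \<le> exp (h * t) + exp (- h * t)"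
      by (simp add: abs_if)
    then show "norm (exp (h * \<bar>t\<bar>)) \<le> norm (exp (h * t) + exp (- h * t))"
      using abs_ge_self[of "exp (h * t) + exp (- h * t)"] by simp
  qed
qed measurable

lemma square_integrable: "integrable (law \<theta>) (\<lambda>t. t\<^sup>2)"
proof (rule Bochner_Integration.integrable_bound)
  show "integrable (law \<theta>) (\<lambda>t. 2 * exp (1 * \<bar>t\<bar>))"
    by (intro integrable_mult_right exp_abs_integrable)
  show "AE t in law \<theta>. norm (t\<^sup>2) \<le> norm (2 * exp (1 * \<bar>t\<bar>))"
  proof (intro AE_I2)
    fix t :: real
    show "norm (t\<^sup>2) \<le> norm (2 * exp (1 * \<bar>t\<bar>))"
      using exp_lower_Taylor_quadratic[of "\<bar>t\<bar>"] by simp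
  qed
qed measurable

lemma id_integrable: "integrable (law \<theta>) (\<lambda>t. t)"
proof -
  interpret prob_space "law \<theta>" by (rule prob_space_law)
  show ?thesis
    by (rule square_integrable_imp_integrable[OF _ square_integrable]) measurable
qed

lemma mgf_has_derivative: "((\<lambda>h. \<integral>t. exp (h * t) \<partial>law \<theta>) has_real_derivative mean \<theta>) (at 0)"
proof -
  interpret prob_space "law \<theta>" by (rule prob_space_law)
  let ?L = "\<lambda>h. \<integral>t. exp (h * t) \<partial>law \<theta>"
  define C where "C = (\<integral>t. exp (2 * \<bar>t\<bar>) \<partial>law \<theta>)"
  have bound: "\<bar>?L h - 1 - h * mean \<theta>\<bar> \<le> h\<^sup>2 * C" if "\<bar>h\<bar> \<le> 1" for h
  proof -
    have "?L h - 1 - h * mean \<theta> = (\<integral>t. exp (h * t) - 1 - h * t \<partial>law \<theta>)"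
      unfolding mean_def using exp_integrable id_integrable by (simp add: prob_space)
    also have "\<bar>\<dots>\<bar> \<le> (\<integral>t. \<bar>exp (h * t) - 1 - h * t\<bar> \<partial>law \<theta>)"
      by (rule integral_abs_bound)
    also have "\<dots> \<le> (\<integral>t. h\<^sup>2 * exp (2 * \<bar>t\<bar>) \<partial>law \<theta>)"
      using exp_integrable id_integrable exp_abs_integrable exp_remainder_bound[OF that]
      by (intro integral_mono) auto
    finally show ?thesis by (simp add: C_def)
  qed
  have quot: "\<bar>(?L h - 1) / h - mean \<theta>\<bar> \<le> \<bar>h\<bar> * C" if "h \<noteq> 0" "\<bar>h\<bar> \<le> 1" for h
  proof -
    have "\<bar>(?L h - 1) / h - mean \<theta>\<bar> = \<bar>?L h - 1 - h * mean \<theta>\<bar> / \<bar>h\<bar>"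
      using that by (simp add: field_simps flip: abs_divide)
    also have "\<dots> \<le> h\<^sup>2 * C / \<bar>h\<bar>"
      using bound[OF that(2)] by (intro divide_right_mono) auto
    also have "\<dots> = \<bar>h\<bar> * C"
      using that by (simp add: power2_eq_square abs_if)
    finally show ?thesis .
  qed
  have "((\<lambda>h. (?L h - 1) / h - mean \<theta>) \<longlongrightarrow> 0) (at 0)"
  proof (rule Lim_null_comparison)
    show "\<forall>\<^sub>F h in at 0. norm ((?L h - 1) / h - mean \<theta>) \<le> \<bar>h\<bar> * C"
      unfolding eventually_at using quot by (intro exI[of _ 1]) (auto simp: dist_real_def)
    show "((\<lambda>h. \<bar>h\<bar> * C) \<longlongrightarrow> 0) (at 0)"
      by (auto intro!: tendsto_eq_intros)
  qed
  then have "((\<lambda>h. (?L h - 1) / h) \<longlongrightarrow> mean \<theta>) (at 0)"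
    by (rule LIM_zero_cancel)
  then show ?thesis
    by (simp add: DERIV_def prob_space)
qed

text \<open>
  By the formula for the moment generating function, \<open>b\<close> is its logarithm up to scaling and
  translation.  Thus differentiability of \<open>b\<close>, which the mean value argument for \<open>B\<close> requires, is a
  consequence of the densities integrating to 1.
\<close>

lemma b_has_derivative: "(b has_real_derivative mean \<theta>) (at \<theta>)"
proof -
  interpret prob_space "law \<theta>" by (rule prob_space_law)
  let ?L = "\<lambda>h. \<integral>t. exp (h * t) \<partial>law \<theta>"
  have b_eq: "b x = b \<theta> + \<phi> * ln (?L ((x - \<theta>) / \<phi>))" for x
    unfolding mgf using \<phi>_nonzero by simp
  have "(?L has_real_derivative mean \<theta>) (at ((\<theta> - \<theta>) / \<phi>))"
    using mgf_has_derivative by simp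
  moreover have "((\<lambda>x. (x - \<theta>) / \<phi>) has_real_derivative 1 / \<phi>) (at \<theta>)"
    using \<phi>_nonzero by (auto intro!: derivative_eq_intros)
  ultimately have "((\<lambda>x. ?L ((x - \<theta>) / \<phi>)) has_real_derivative mean \<theta> * (1 / \<phi>)) (at \<theta>)"
    by (rule DERIV_chain2)
  then have "((\<lambda>x. b \<theta> + \<phi> * ln (?L ((x - \<theta>) / \<phi>))) has_real_derivative mean \<theta>) (at \<theta>)"
    using \<phi>_nonzero by (auto intro!: derivative_eq_intros simp: prob_space)
  moreover have "(\<lambda>x. b \<theta> + \<phi> * ln (?L ((x - \<theta>) / \<phi>))) = b"
    by (rule ext) (rule b_eq[symmetric])
  ultimately show ?thesis by simp
qed

lemma KL_div_eq: "KL_div \<nu> b c \<phi> \<theta>0 \<theta> = (mean \<theta>0 * (\<theta>0 - \<theta>) - b \<theta>0 + b \<theta>) / \<phi>"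
proof -
  interpret prob_space "law \<theta>0" by (rule prob_space_law)
  have "KL_div \<nu> b c \<phi> \<theta>0 \<theta> = (\<integral>t. t * ((\<theta>0 - \<theta>) / \<phi>) + (b \<theta> - b \<theta>0) / \<phi> \<partial>law \<theta>0)"
    unfolding KL_div_def law_def[symmetric]
    by (rule Bochner_Integration.integral_cong) (auto simp: expfam_def field_simps diff_divide_distrib add_divide_distrib)
  also have "\<dots> = mean \<theta>0 * ((\<theta>0 - \<theta>) / \<phi>) + (b \<theta> - b \<theta>0) / \<phi>"
    using id_integrable by (simp add: prob_space mean_def)
  finally show ?thesis by (simp add: diff_divide_distrib add_divide_distrib right_diff_distrib)
qed

text \<open>
  Gibbs' inequality.  Jensen's inequality for the exponential tilt \<open>exp (h * t)\<close>, with \<open>h\<close> the tilt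
  leading from \<open>\<theta>0\<close> to \<open>\<theta>\<close>, gives the claim for either sign of \<open>\<phi>\<close>, where convexity of \<open>b\<close>
  itself would hold only for positive \<open>\<phi>\<close>.
\<close>

lemma KL_div_nonneg: "KL_div \<nu> b c \<phi> \<theta>0 \<theta> \<ge> 0"
proof -
  interpret prob_space "law \<theta>0" by (rule prob_space_law)
  define h where "h = (\<theta> - \<theta>0) / \<phi>"
  \<comment> \<open>the tangent of the exponential function at \<open>h * mean \<theta>0\<close>\<close>
  have tangent: "exp (h * mean \<theta>0) * (1 + h * (t - mean \<theta>0)) \<le> exp (h * t)" for t
  proof -
    have "exp (h * mean \<theta>0) * (1 + h * (t - mean \<theta>0)) \<le> exp (h * mean \<theta>0) * exp (h * (t - mean \<theta>0))"
      by (intro mult_left_mono) auto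
    then show ?thesis by (simp add: algebra_simps flip: exp_add)
  qed
  have "exp (h * mean \<theta>0) = (\<integral>t. exp (h * mean \<theta>0) * (1 + h * (t - mean \<theta>0)) \<partial>law \<theta>0)"
    using id_integrable by (simp add: prob_space mean_def)
  also have "\<dots> \<le> (\<integral>t. exp (h * t) \<partial>law \<theta>0)"
    using id_integrable exp_integrable tangent by (intro integral_mono) auto
  also have "\<dots> = exp ((b \<theta> - b \<theta>0) / \<phi>)"
    unfolding mgf using \<phi>_nonzero by (simp add: h_def)
  finally have "h * mean \<theta>0 \<le> (b \<theta> - b \<theta>0) / \<phi>" by simp
  then show ?thesis
    unfolding KL_div_eq h_def by (simp add: diff_divide_distrib add_divide_distrib algebra_simps)
qed

lemma Bsum_differentiable: "Bsum b n Xt differentiable (at z)"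
proof -
  have "(\<lambda>\<beta>. b (Xt i \<bullet> \<beta>)) differentiable (at z)" for i
  proof (rule differentiable_compose[of b])
    show "b differentiable (at (Xt i \<bullet> z))"
      using b_has_derivative real_differentiable_def by blast
    show "(\<lambda>\<beta>. Xt i \<bullet> \<beta>) differentiable (at z)"
      by (intro bounded_linear_imp_differentiable bounded_linear_inner_right)
  qed
  then show ?thesis
    unfolding Bsum_def[abs_def] by (intro differentiable_sum) auto
qed

text \<open>
  The Kullback-Leibler loss of the estimator and its deterministic counterpart are the same function,
  evaluated at \<open>\<beta>hat(w)\<close> and at \<open>\<beta>star(w)\<close>; their difference is governed by the distance of the two
  parameters, and the non-negativity of the loss carries over to \<open>KL_star\<close>.
\<close>

lemma KL_loss_eq_KL_star:
  assumes "\<And>i. i \<in> {1..n} \<Longrightarrow> \<mu> i = mean (\<theta>0 i)"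
  shows "KL_loss \<nu> b c \<phi> n \<theta>0 Xt \<beta> = KL_star b \<phi> n \<theta>0 \<mu> Xt \<beta>"
proof -
  have "KL_loss \<nu> b c \<phi> n \<theta>0 Xt \<beta>
      = 2 * (\<Sum>i=1..n. (b (Xt i \<bullet> \<beta>) - b (\<theta>0 i) - \<mu> i * (Xt i \<bullet> \<beta> - \<theta>0 i)) / \<phi>)"
    unfolding KL_loss_def KL_div_eq using assms
    by (intro arg_cong2[of _ _ _ _ "(*)"] sum.cong refl) (simp add: algebra_simps)
  also have "\<dots> = 2 / \<phi> * (Bsum b n Xt \<beta> - (\<Sum>i=1..n. b (\<theta>0 i))
      - (\<Sum>i=1..n. \<mu> i * (Xt i \<bullet> \<beta> - \<theta>0 i)))"
    by (simp add: Bsum_def sum_subtractf flip: sum_divide_distrib)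
  also have "\<dots> = KL_star b \<phi> n \<theta>0 \<mu> Xt \<beta>"
    by (simp add: KL_star_def right_diff_distrib)
  finally show ?thesis .
qed

lemma KL_loss_nonneg: "KL_loss \<nu> b c \<phi> n \<theta>0 Xt \<beta> \<ge> 0"
  unfolding KL_loss_def using KL_div_nonneg by (simp add: sum_nonneg)

lemma distributed_expfam:
  assumes "distributed M \<nu> Y (\<lambda>t. ennreal (expfam b c \<phi> \<theta> t))"
  shows "Y \<in> borel_measurable M" "distr M borel Y = law \<theta>"
proof -
  show Y: "Y \<in> borel_measurable M"
    using assms measurable_cong_sets[OF refl sets_\<nu>] by (auto simp: distributed_def)
  show "distr M borel Y = law \<theta>"
    using assms by (simp add: distributed_def law_def distr_cong[OF refl sets_\<nu>[symmetric]])
qed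

lemma
  assumes "distributed M \<nu> Y (\<lambda>t. ennreal (expfam b c \<phi> \<theta> t))"
  shows response_mean: "(\<integral>\<omega>. Y \<omega> \<partial>M) = mean \<theta>"
    and response_integrable: "integrable M Y"
    and response_square_integrable: "integrable M (\<lambda>\<omega>. (Y \<omega>)\<^sup>2)"
proof -
  note Y = distributed_expfam[OF assms]
  show "(\<integral>\<omega>. Y \<omega> \<partial>M) = mean \<theta>"
    unfolding mean_def Y(2)[symmetric] using Y(1) by (simp add: integral_distr)
  show "integrable M Y"
    using id_integrable[of \<theta>] Y(1) unfolding Y(2)[symmetric] by (simp add: integrable_distr_eq)
  show "integrable M (\<lambda>\<omega>. (Y \<omega>)\<^sup>2)"
    using square_integrable[of \<theta>] Y(1) unfolding Y(2)[symmetric] by (simp add: integrable_distr_eq)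
qed

end

section \<open>Mean values along a segment\<close>

lemma gradient_derivative:
  fixes F :: "real^'k \<Rightarrow> real"
  assumes "F differentiable (at z)"
  shows "(F has_derivative (\<lambda>v. gradient F z \<bullet> v)) (at z)"
proof -
  let ?D = "frechet_derivative F (at z)"
  have D: "(F has_derivative ?D) (at z)"
    using assms by (simp add: frechet_derivative_works)
  then have "linear ?D" by (rule has_derivative_linear)
  have "?D v = gradient F z \<bullet> v" for v
  proof -
    have "?D v = ?D (\<Sum>j\<in>UNIV. v $ j *\<^sub>R axis j 1)"
      using basis_expansion[of v] by (simp add: scalar_mult_eq_scaleR)
    also have "\<dots> = (\<Sum>j\<in>UNIV. v $ j * ?D (axis j 1))"
      using \<open>linear ?D\<close> by (simp add: linear_sum linear_cmul)
    also have "\<dots> = gradient F z \<bullet> v"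
      by (simp add: gradient_def inner_vec_def mult.commute)
    finally show ?thesis .
  qed
  then have "?D = (\<lambda>v. gradient F z \<bullet> v)" by blast
  with D show ?thesis by simp
qed

text \<open>
  The mean value theorem on a segment.  The intermediate point is what turns the gradient bound
  between \<open>\<beta>hat(w)\<close> and \<open>\<beta>star(w)\<close> into a bound for the increment of \<open>B\<close>.
\<close>

lemma gradient_mean_value:
  fixes F :: "real^'k \<Rightarrow> real"
  assumes "\<And>z. F differentiable (at z)"
  shows "\<exists>z\<in>closed_segment x u. \<bar>F x - F u\<bar> \<le> norm (gradient F z) * norm (x - u)"
proof -
  define l where "l t = u + t *\<^sub>R (x - u)" for t
  have deriv: "((\<lambda>t. F (l t)) has_derivative (\<lambda>s. gradient F (l t) \<bullet> (s *\<^sub>R (x - u)))) (at t within {0..1})"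
    for t
  proof -
    have "(l has_derivative (\<lambda>s. s *\<^sub>R (x - u))) (at t within {0..1})"
      unfolding l_def by (auto intro!: derivative_eq_intros)
    then show ?thesis
      using gradient_derivative[OF assms] by (rule has_derivative_compose)
  qed
  obtain t where t: "t \<in> {0..1}" "F (l 1) - F (l 0) = gradient F (l t) \<bullet> ((1 - 0) *\<^sub>R (x - u))"
    using mvt_very_simple[of 0 1 "\<lambda>t. F (l t)" "\<lambda>t s. gradient F (l t) \<bullet> (s *\<^sub>R (x - u))"] deriv
    by auto
  have "l t = (1 - t) *\<^sub>R u + t *\<^sub>R x"
    by (simp add: l_def algebra_simps)
  then have "l t \<in> closed_segment u x"
    using t(1) by (auto simp: closed_segment_def)
  then have "l t \<in> closed_segment x u"
    by (simp add: closed_segment_commute)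
  moreover have "\<bar>F x - F u\<bar> \<le> norm (gradient F (l t)) * norm (x - u)"
    using t(2) Cauchy_Schwarz_ineq2[of "gradient F (l t)" "x - u"] by (simp add: l_def)
  ultimately show ?thesis by blast
qed

section \<open>Weighted sums of independent errors\<close>

lemma (in prob_space) second_moment_weighted_sum_indep:
  fixes e :: "'i \<Rightarrow> 'a \<Rightarrow> real"
  assumes "finite I" and indep: "indep_vars (\<lambda>_. borel) e I"
    and sq: "\<And>i. i \<in> I \<Longrightarrow> integrable M (\<lambda>\<omega>. (e i \<omega>)\<^sup>2)"
    and centred: "\<And>i. i \<in> I \<Longrightarrow> expectation (e i) = 0"
  shows "integrable M (\<lambda>\<omega>. (\<Sum>i\<in>I. e i \<omega> * a i)\<^sup>2)" (is ?int)
    and "expectation (\<lambda>\<omega>. (\<Sum>i\<in>I. e i \<omega> * a i)\<^sup>2) = (\<Sum>i\<in>I. (a i)\<^sup>2 * variance (e i))" (is ?eq)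
proof -
  have rv [measurable]: "e i \<in> borel_measurable M" if "i \<in> I" for i
    using indep that unfolding indep_vars_def by auto
  have int: "integrable M (e i)" if "i \<in> I" for i
    using square_integrable_imp_integrable rv sq that by blast
  have prod: "integrable M (\<lambda>\<omega>. e i \<omega> * e j \<omega>) \<and>
      expectation (\<lambda>\<omega>. e i \<omega> * e j \<omega>) = (if i = j then variance (e i) else 0)"
    if "i \<in> I" "j \<in> I" for i j
  proof (cases "i = j")
    case True
    then show ?thesis using sq that centred by (simp add: power2_eq_square)
  next
    case False
    have "indep_vars (\<lambda>_. borel) e {i, j}"
      using indep_vars_subset[OF indep, of "{i, j}"] that by auto
    then show ?thesis
      using indep_vars_integrable[of "{i, j}" e] indep_vars_lebesgue_integral[of "{i, j}" e]
        int that centred False by auto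
  qed
  have expand: "(\<Sum>i\<in>I. e i \<omega> * a i)\<^sup>2 = (\<Sum>i\<in>I. \<Sum>j\<in>I. a i * a j * (e i \<omega> * e j \<omega>))" for \<omega>
    by (simp add: power2_eq_square sum_product ac_simps)
  show ?int
    unfolding expand using prod by (intro Bochner_Integration.integrable_sum integrable_mult_right) auto
  have "expectation (\<lambda>\<omega>. (\<Sum>i\<in>I. e i \<omega> * a i)\<^sup>2)
      = (\<Sum>i\<in>I. \<Sum>j\<in>I. a i * a j * (if i = j then variance (e i) else 0))"
    unfolding expand using prod
    by (subst Bochner_Integration.integral_sum, force intro!: Bochner_Integration.integrable_sum)+
       (simp cong: sum.cong)
  also have "\<dots> = (\<Sum>i\<in>I. (a i)\<^sup>2 * variance (e i))"
    using \<open>finite I\<close> by (simp add: if_distrib[of "\<lambda>x. _ * x"] power2_eq_square cong: if_cong)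
  finally show ?eq .
qed

text \<open>
  By independence the variance of the sum is at most the maximal variance times \<open>\<Sum>i. (a n i)\<^sup>2\<close>, hence
  at most \<open>C * n\<close>.  Applied with \<open>a n i = \<theta>\<^sub>i(\<beta>star n s)\<close>: the estimation rate makes the noise along
  \<open>\<beta>hat - \<beta>star\<close> small, but along \<open>\<beta>star\<close> itself only cancellation of independent errors helps.
\<close>

lemma Op_weighted_sum_indep:
  fixes e :: "nat \<Rightarrow> nat \<Rightarrow> 'a \<Rightarrow> real"
  assumes prob: "\<And>n. prob_space (M n)"
    and indep: "\<And>n. prob_space.indep_vars (M n) (\<lambda>_. borel) (e n) {1..n}"
    and sq: "\<And>n i. i \<in> {1..n} \<Longrightarrow> integrable (M n) (\<lambda>\<omega>. (e n i \<omega>)\<^sup>2)"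
    and centred: "\<And>n i. i \<in> {1..n} \<Longrightarrow> (\<integral>\<omega>. e n i \<omega> \<partial>M n) = 0"
    and bound: "\<forall>\<^sub>F n in sequentially.
      (MAX i\<in>{1..n}. prob_space.variance (M n) (e n i)) * (\<Sum>i=1..n. (a n i)\<^sup>2) / real n \<le> C"
  shows "Op M (\<lambda>n \<omega>. \<Sum>i=1..n. e n i \<omega> * a n i) (\<lambda>n. real n powr (1/2))"
proof (rule Op_second_moment[where C = C])
  show "\<forall>\<^sub>F n in sequentially. integrable (M n) (\<lambda>\<omega>. (\<Sum>i=1..n. e n i \<omega> * a n i)\<^sup>2) \<and>
      (\<lambda>\<omega>. \<Sum>i=1..n. e n i \<omega> * a n i) \<in> borel_measurable (M n) \<and>
      (\<integral>\<omega>. (\<Sum>i=1..n. e n i \<omega> * a n i)\<^sup>2 \<partial>M n) \<le> C * (real n powr (1/2))\<^sup>2 \<and>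
      real n powr (1/2) > 0"
    using bound eventually_ge_at_top[of 1]
  proof eventually_elim
    case (elim n)
    interpret prob_space "M n" by (rule prob)
    have [measurable]: "e n i \<in> borel_measurable (M n)" if "i \<in> {1..n}" for i
      using indep[of n] that unfolding indep_vars_def by auto
    let ?v = "MAX i\<in>{1..n}. variance (e n i)"
    note moment = second_moment_weighted_sum_indep[OF finite_atLeastAtMost indep[of n] sq centred, where a = "a n"]
    have "(\<Sum>i=1..n. (a n i)\<^sup>2 * variance (e n i)) \<le> (\<Sum>i=1..n. (a n i)\<^sup>2 * ?v)"
      by (intro sum_mono mult_left_mono Max_ge) auto
    also have "\<dots> \<le> C * real n"
      using elim by (simp add: field_simps flip: sum_distrib_right)
    finally show ?case
      using elim moment by (simp add: powr_half_sqrt)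
  qed
qed

section \<open>Weighted averages of parameter vectors\<close>

lemma avg_inner: "x \<bullet> avg S w \<beta> = (\<Sum>s=1..S. w s * (x \<bullet> \<beta> s))"
  by (simp add: avg_def inner_sum_right)

lemma weights_bounds:
  assumes "w \<in> weights S" "s \<in> {1..S}"
  shows "0 \<le> w s" "w s \<le> 1"
  using assms by (auto simp: weights_def)

lemma weighted_sum_abs_le:
  assumes "w \<in> weights S"
  shows "\<bar>\<Sum>s=1..S. w s * x s\<bar> \<le> (\<Sum>s=1..S. \<bar>x s\<bar>)"
proof -
  have "\<bar>\<Sum>s=1..S. w s * x s\<bar> \<le> (\<Sum>s=1..S. \<bar>w s * x s\<bar>)" by (rule sum_abs)
  also have "\<dots> \<le> (\<Sum>s=1..S. \<bar>x s\<bar>)"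
    using weights_bounds[OF assms] by (intro sum_mono) (auto simp: abs_mult intro!: mult_left_le_one_le)
  finally show ?thesis .
qed

lemma norm_avg_diff_le:
  assumes "w \<in> weights S"
  shows "norm (avg S w \<beta> - avg S w \<gamma>) \<le> (\<Sum>s=1..S. norm (\<beta> s - \<gamma> s))"
proof -
  have "avg S w \<beta> - avg S w \<gamma> = (\<Sum>s=1..S. w s *\<^sub>R (\<beta> s - \<gamma> s))"
    by (simp add: avg_def sum_subtractf scaleR_diff_right)
  also have "norm \<dots> \<le> (\<Sum>s=1..S. norm (w s *\<^sub>R (\<beta> s - \<gamma> s)))"
    by (rule norm_sum)
  also have "\<dots> \<le> (\<Sum>s=1..S. norm (\<beta> s - \<gamma> s))"
    using weights_bounds[OF assms] by (intro sum_mono) (auto intro!: mult_left_le_one_le)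
  finally show ?thesis .
qed

section \<open>Asymptotic optimality of the selected weights\<close>

text \<open>
  The deterministic core.  If the criterion \<open>Q\<close> equals the loss \<open>L\<close> up to a constant \<open>\<kappa>\<close> and an error
  of at most \<open>a * \<xi>\<close>, its minimizer loses at most \<open>2 * a * \<xi>\<close> against the infimum of \<open>L\<close>.  The
  infimum is itself at least \<open>(1 - a) * \<xi>\<close>, so this loss is small in relative terms.
\<close>

lemma argmin_loss_ratio:
  fixes L Ls Q :: "'w \<Rightarrow> real"
  assumes close_L: "\<And>w. w \<in> W \<Longrightarrow> \<bar>L w - Ls w\<bar> \<le> a * \<xi>"
    and close_Q: "\<And>w. w \<in> W \<Longrightarrow> \<bar>Q w - L w - \<kappa>\<bar> \<le> a * \<xi>"
    and lower: "\<And>w. w \<in> W \<Longrightarrow> \<xi> \<le> Ls w" and "\<xi> > 0" and a: "0 \<le> a" "a < 1"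
    and argmin: "is_arg_min Q (\<lambda>w. w \<in> W) v"
  shows "\<bar>L v / (INF w\<in>W. L w) - 1\<bar> \<le> 2 * a / (1 - a)"
proof -
  have v: "v \<in> W" "\<And>w. w \<in> W \<Longrightarrow> Q v \<le> Q w"
    using argmin by (auto simp: is_arg_min_linorder)
  define m where "m = (INF w\<in>W. L w)"
  have low: "(1 - a) * \<xi> \<le> L w" if "w \<in> W" for w
    using close_L[OF that] lower[OF that] by (simp add: algebra_simps)
  have m_low: "(1 - a) * \<xi> \<le> m"
    unfolding m_def using v(1) low by (intro cINF_greatest) auto
  have m_up: "m \<le> L v"
    unfolding m_def using low by (intro cINF_lower[OF _ v(1)] bdd_belowI2)
  have "L v - 2 * (a * \<xi>) \<le> m"
    unfolding m_def
  proof (rule cINF_greatest)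
    fix w assume "w \<in> W"
    then show "L v - 2 * (a * \<xi>) \<le> L w"
      using close_Q[of w] close_Q[OF v(1)] v(2)[of w] by linarith
  qed (use v in auto)
  moreover have "a * \<xi> \<le> a / (1 - a) * m"
    using mult_left_mono[OF m_low, of "a / (1 - a)"] a by simp
  ultimately have "L v - m \<le> 2 * a / (1 - a) * m" by simp
  moreover have "m > 0"
    using m_low \<open>\<xi> > 0\<close> a by (smt (verit) mult_pos_pos)
  ultimately show ?thesis
    using m_up unfolding m_def[symmetric] by (simp add: field_simps)
qed

theorem theorem1:
  fixes M :: "nat \<Rightarrow> 'a measure" and y :: "nat \<Rightarrow> nat \<Rightarrow> 'a \<Rightarrow> real"
    and \<nu> :: "real measure" and b :: "real \<Rightarrow> real" and c :: "real \<Rightarrow> real \<Rightarrow> real" and \<phi> :: real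
    and \<theta>0 \<mu> :: "nat \<Rightarrow> nat \<Rightarrow> real" and \<epsilon> :: "nat \<Rightarrow> nat \<Rightarrow> 'a \<Rightarrow> real" and \<sigma>2 :: "nat \<Rightarrow> real"
    and X Xt :: "nat \<Rightarrow> nat \<Rightarrow> real^'k" and mis :: "nat \<Rightarrow> nat \<Rightarrow> 'k \<Rightarrow> bool"
    and S :: nat and \<zeta> :: "nat \<Rightarrow> nat \<Rightarrow> 'k set" and obs :: "nat \<Rightarrow> nat \<Rightarrow> nat set"
    and \<beta>hat :: "nat \<Rightarrow> 'a \<Rightarrow> nat \<Rightarrow> real^'k" and \<beta>star :: "nat \<Rightarrow> nat \<Rightarrow> real^'k"
    and KL G :: "nat \<Rightarrow> (nat \<Rightarrow> real) \<Rightarrow> 'a \<Rightarrow> real" and KLstar :: "nat \<Rightarrow> (nat \<Rightarrow> real) \<Rightarrow> real"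
    and \<xi> lam :: "nat \<Rightarrow> real" and what :: "nat \<Rightarrow> 'a \<Rightarrow> nat \<Rightarrow> real"
  \<comment> \<open>data generating process\<close>
  assumes family: "exponential_family \<nu> b c \<phi>"
    and prob: "\<And>n. prob_space (M n)"
    and indep: "\<And>n. prob_space.indep_vars (M n) (\<lambda>_. borel) (y n) {1..n}"
    and dens: "\<And>n i. i \<in> {1..n} \<Longrightarrow>
        distributed (M n) \<nu> (y n i) (\<lambda>t. ennreal (expfam b c \<phi> (\<theta>0 n i) t))"
    and mu: "\<And>n i. \<mu> n i = (\<integral>\<omega>. y n i \<omega> \<partial>M n)"
    and eps: "\<And>n i \<omega>. \<epsilon> n i \<omega> = y n i \<omega> - \<mu> n i"
    and sigma: "\<And>n. \<sigma>2 n = (MAX i\<in>{1..n}. prob_space.variance (M n) (\<epsilon> n i))"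
  \<comment> \<open>missing covariates and candidate models\<close>
    and Xt: "\<And>n. Xt n = zero_fill (mis n) (X n)"
    and obs: "\<And>n s. obs n s = used_obs (mis n) n (\<zeta> n s)"
    and models: "\<forall>\<^sub>F n in sequentially. candidate_models (mis n) n S (\<zeta> n)"
    and rank: "\<forall>\<^sub>F n in sequentially. \<forall>s\<in>{1..S}. full_column_rank (X n) (obs n s) (\<zeta> n s)"
    and rank_Xt: "\<forall>\<^sub>F n in sequentially. full_column_rank (Xt n) {1..n} UNIV"
    and bhat_supp: "\<forall>\<^sub>F n in sequentially. \<forall>s\<in>{1..S}. \<forall>\<omega>\<in>space (M n).
        supported_on (\<zeta> n s) (\<beta>hat n \<omega> s)"
    and bhat: "\<forall>\<^sub>F n in sequentially. \<forall>s\<in>{1..S}. \<forall>\<omega>\<in>space (M n).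
        (\<exists>\<beta>. is_MLE b c \<phi> (\<lambda>i. y n i \<omega>) (X n) (obs n s) (\<zeta> n s) \<beta>) \<longrightarrow>
        is_MLE b c \<phi> (\<lambda>i. y n i \<omega>) (X n) (obs n s) (\<zeta> n s) (\<beta>hat n \<omega> s)"
    and bstar: "\<forall>\<^sub>F n in sequentially. \<forall>s\<in>{1..S}.
        is_KL_minimizer \<nu> b c \<phi> (\<theta>0 n) (X n) (obs n s) (\<zeta> n s) (\<beta>star n s)"
  \<comment> \<open>losses and criterion\<close>
    and KL: "\<And>n w \<omega>. KL n w \<omega> = KL_loss \<nu> b c \<phi> n (\<theta>0 n) (Xt n) (avg S w (\<beta>hat n \<omega>))"
    and KLstar: "\<And>n w. KLstar n w = KL_star b \<phi> n (\<theta>0 n) (\<mu> n) (Xt n) (avg S w (\<beta>star n))"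
    and xi: "\<And>n. \<xi> n = (INF w\<in>weights S. KLstar n w)"
    and G: "\<And>n w \<omega>. G n w \<omega> = criterion b \<phi> n (\<lambda>i. y n i \<omega>) (Xt n) (avg S w (\<beta>hat n \<omega>))
        (lam n * (\<Sum>s=1..S. w s * real (card (\<zeta> n s))))"
  \<comment> \<open>conditions (i) to (v)\<close>
    and cond_i: "\<forall>s\<in>{1..S}.
        Op M (\<lambda>n \<omega>. norm (\<beta>hat n \<omega> s - \<beta>star n s)) (\<lambda>n. real n powr (-1/2))"
    and cond_ii_mu: "(\<lambda>n. norm (\<Sum>i=1..n. \<mu> n i *\<^sub>R Xt n i)) \<in> O(\<lambda>n. real n)"
    and cond_ii_eps: "Op M (\<lambda>n \<omega>. norm (\<Sum>i=1..n. \<epsilon> n i \<omega> *\<^sub>R Xt n i)) (\<lambda>n. real n powr (1/2))"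
    and cond_ii_B: "\<forall>\<beta>tilde :: nat \<Rightarrow> (nat \<Rightarrow> real) \<Rightarrow> 'a \<Rightarrow> real^'k.
        (\<forall>n. \<forall>w\<in>weights S. \<forall>\<omega>\<in>space (M n).
           \<beta>tilde n w \<omega> \<in> closed_segment (avg S w (\<beta>hat n \<omega>)) (avg S w (\<beta>star n))) \<longrightarrow>
        Op_unif M (weights S) (\<lambda>n w \<omega>. norm (gradient (Bsum b n (Xt n)) (\<beta>tilde n w \<omega>)))
          (\<lambda>n. real n)"
    and cond_iii: "\<exists>C. \<forall>\<^sub>F n in sequentially. \<forall>s\<in>{1..S}.
        \<sigma>2 n * (\<Sum>i=1..n. (Xt n i \<bullet> \<beta>star n s)\<^sup>2) / real n \<le> C"
    and cond_iv: "\<forall>\<^sub>F n in sequentially. \<xi> n \<noteq> 0"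
        "(\<lambda>n. real n / (\<xi> n)\<^sup>2) \<in> o(\<lambda>_. 1)"
    and cond_v: "(\<lambda>n. real n powr (-1/2) * lam n) \<in> O(\<lambda>_. 1)"
  \<comment> \<open>selected weights\<close>
    and what: "\<And>n \<omega>. \<omega> \<in> space (M n) \<Longrightarrow>
        is_arg_min (\<lambda>w. G n w \<omega>) (\<lambda>w. w \<in> weights S) (what n \<omega>)"
  shows "tendsto_in_prob M (\<lambda>n \<omega>. KL n (what n \<omega>) \<omega> / (INF w\<in>weights S. KL n w \<omega>)) 1"
proof -
  interpret exp_family \<nu> b c \<phi> by (rule exp_family.intro[OF family])
  let ?W = "weights S" and ?R = "\<lambda>n. real n powr (1/2)"

  have \<mu>_mean: "\<mu> n i = mean (\<theta>0 n i)" if "i \<in> {1..n}" for n i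
    unfolding mu using response_mean[OF dens[OF that]] .
  have KL_eq: "KL n w \<omega> = KL_star b \<phi> n (\<theta>0 n) (\<mu> n) (Xt n) (avg S w (\<beta>hat n \<omega>))" for n w \<omega>
    unfolding KL by (rule KL_loss_eq_KL_star) (rule \<mu>_mean)
  have KLstar_nonneg: "0 \<le> KLstar n w" for n w
  proof -
    have "KLstar n w = KL_loss \<nu> b c \<phi> n (\<theta>0 n) (Xt n) (avg S w (\<beta>star n))"
      unfolding KLstar by (rule KL_loss_eq_KL_star[symmetric]) (rule \<mu>_mean)
    then show ?thesis by (simp add: KL_loss_nonneg)
  qed

  \<comment> \<open>the sizes of all random and deterministic errors, separated from the weights\<close>
  define D where "D n \<omega> = (\<Sum>s=1..S. norm (\<beta>hat n \<omega> s - \<beta>star n s))" for n \<omega>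
  define mX where "mX n = norm (\<Sum>i=1..n. \<mu> n i *\<^sub>R Xt n i)" for n
  define eX where "eX n \<omega> = norm (\<Sum>i=1..n. \<epsilon> n i \<omega> *\<^sub>R Xt n i)" for n \<omega>
  define N where "N s n \<omega> = (\<Sum>i=1..n. \<epsilon> n i \<omega> * (Xt n i \<bullet> \<beta>star n s))" for s n \<omega>
  have D_nonneg: "0 \<le> D n \<omega>" for n \<omega>
    by (simp add: D_def sum_nonneg)
  have avg_close: "norm (avg S w (\<beta>hat n \<omega>) - avg S w (\<beta>star n)) \<le> D n \<omega>" if "w \<in> ?W" for n w \<omega>
    unfolding D_def using norm_avg_diff_le[OF that] .

  \<comment> \<open>one intermediate point for each \<open>n\<close>, \<open>w\<close> and \<open>\<omega>\<close>, so that the gradient condition applies to the resulting family\<close>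
  define mean_value where "mean_value n w \<omega> z \<longleftrightarrow>
      z \<in> closed_segment (avg S w (\<beta>hat n \<omega>)) (avg S w (\<beta>star n)) \<and>
      \<bar>Bsum b n (Xt n) (avg S w (\<beta>hat n \<omega>)) - Bsum b n (Xt n) (avg S w (\<beta>star n))\<bar>
        \<le> norm (gradient (Bsum b n (Xt n)) z) * norm (avg S w (\<beta>hat n \<omega>) - avg S w (\<beta>star n))"
    for n w \<omega> z
  define z where "z n w \<omega> = (SOME z. mean_value n w \<omega> z)" for n w \<omega>
  have "\<exists>z. mean_value n w \<omega> z" for n w \<omega>
    using gradient_mean_value[OF Bsum_differentiable] unfolding mean_value_def Bex_def .
  then have "mean_value n w \<omega> (z n w \<omega>)" for n w \<omega>
    unfolding z_def by (rule someI_ex)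
  then have z: "z n w \<omega> \<in> closed_segment (avg S w (\<beta>hat n \<omega>)) (avg S w (\<beta>star n))"
    and z_bound: "\<bar>Bsum b n (Xt n) (avg S w (\<beta>hat n \<omega>)) - Bsum b n (Xt n) (avg S w (\<beta>star n))\<bar>
        \<le> norm (gradient (Bsum b n (Xt n)) (z n w \<omega>))
          * norm (avg S w (\<beta>hat n \<omega>) - avg S w (\<beta>star n))" for n w \<omega>
    unfolding mean_value_def by auto
  define g where "g n w \<omega> = norm (gradient (Bsum b n (Xt n)) (z n w \<omega>))" for n w \<omega>

  \<comment> \<open>a common bound, of order \<open>n\<^bsup>1/2\<^esup>\<close>, for both approximation errors\<close>
  define U where "U n w \<omega> = \<bar>2 / \<phi>\<bar> * (g n w \<omega> * D n \<omega> + mX n * D n \<omega> + eX n \<omega> * D n \<omega>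
      + (\<Sum>s=1..S. \<bar>N s n \<omega>\<bar>)) + real CARD('k) * \<bar>lam n\<bar>" for n w \<omega>
  \<comment> \<open>the part of the loss that does not involve the weights, hence does not influence the minimizer\<close>
  define \<kappa> where "\<kappa> n = 2 / \<phi> * ((\<Sum>i=1..n. b (\<theta>0 n i)) - (\<Sum>i=1..n. \<mu> n i * \<theta>0 n i))" for n

  have loss_close: "\<bar>KL n w \<omega> - KLstar n w\<bar> \<le> U n w \<omega>" if w: "w \<in> ?W" for n w \<omega>
  proof -
    let ?h = "avg S w (\<beta>hat n \<omega>)" and ?s = "avg S w (\<beta>star n)"
    let ?B = "Bsum b n (Xt n) ?h - Bsum b n (Xt n) ?s"
    let ?m = "(\<Sum>i=1..n. \<mu> n i *\<^sub>R Xt n i) \<bullet> (?h - ?s)"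
    have m: "?m = (\<Sum>i=1..n. \<mu> n i * (Xt n i \<bullet> ?h - \<theta>0 n i)) - (\<Sum>i=1..n. \<mu> n i * (Xt n i \<bullet> ?s - \<theta>0 n i))"
      by (simp add: inner_sum_left inner_diff_right right_diff_distrib sum_subtractf)
    have alg: "(k * B - k * B0 - k * m) - (k * B' - k * B0 - k * m') = k * ((B - B') - (m - m'))"
      for k B B' B0 m m' :: real by (simp add: algebra_simps)
    have "KL n w \<omega> - KLstar n w = 2 / \<phi> * (?B - ?m)"
      unfolding KL_eq KLstar KL_star_def m by (rule alg)
    then have "\<bar>KL n w \<omega> - KLstar n w\<bar> = \<bar>2 / \<phi>\<bar> * \<bar>?B - ?m\<bar>"
      by (simp only: abs_mult)
    also have "\<dots> \<le> \<bar>2 / \<phi>\<bar> * (g n w \<omega> * D n \<omega> + mX n * D n \<omega>)"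
    proof (rule mult_left_mono)
      have "\<bar>?B\<bar> \<le> g n w \<omega> * D n \<omega>"
        using z_bound avg_close[OF w] unfolding g_def
        by (rule order_trans[OF _ mult_left_mono]) auto
      moreover have "\<bar>?m\<bar> \<le> mX n * D n \<omega>"
        using Cauchy_Schwarz_ineq2 avg_close[OF w] unfolding mX_def
        by (rule order_trans[OF _ mult_left_mono]) auto
      ultimately show "\<bar>?B - ?m\<bar> \<le> g n w \<omega> * D n \<omega> + mX n * D n \<omega>" by linarith
    qed simp
    also have "\<dots> \<le> U n w \<omega>"
    proof -
      have "0 \<le> eX n \<omega> * D n \<omega> + (\<Sum>s=1..S. \<bar>N s n \<omega>\<bar>)"
        using D_nonneg by (simp add: eX_def sum_nonneg)
      then have "\<bar>2 / \<phi>\<bar> * (g n w \<omega> * D n \<omega> + mX n * D n \<omega>)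
          \<le> \<bar>2 / \<phi>\<bar> * (g n w \<omega> * D n \<omega> + mX n * D n \<omega> + eX n \<omega> * D n \<omega> + (\<Sum>s=1..S. \<bar>N s n \<omega>\<bar>))"
        by (intro mult_left_mono) auto
      moreover have "0 \<le> real CARD('k) * \<bar>lam n\<bar>" by simp
      ultimately show ?thesis unfolding U_def by linarith
    qed
    finally show ?thesis .
  qed

  have criterion_close: "\<bar>G n w \<omega> - KL n w \<omega> - \<kappa> n\<bar> \<le> U n w \<omega>" if w: "w \<in> ?W" for n w \<omega>
  proof -
    let ?h = "avg S w (\<beta>hat n \<omega>)" and ?s = "avg S w (\<beta>star n)"
    let ?e = "(\<Sum>i=1..n. \<epsilon> n i \<omega> *\<^sub>R Xt n i)"
    let ?pen = "\<Sum>s=1..S. w s * real (card (\<zeta> n s))"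
    have e: "?e \<bullet> ?h = (\<Sum>i=1..n. y n i \<omega> * (Xt n i \<bullet> ?h)) - (\<Sum>i=1..n. \<mu> n i * (Xt n i \<bullet> ?h - \<theta>0 n i))
        - (\<Sum>i=1..n. \<mu> n i * \<theta>0 n i)"
      by (simp add: eps inner_sum_left left_diff_distrib right_diff_distrib sum_subtractf)
    have alg: "(k * B - k * Y + p) - (k * B - k * B0 - k * m) - k * (B0 - t) = - k * (Y - m - t) + p"
      for k B B0 Y m t p :: real by (simp add: algebra_simps)
    have "G n w \<omega> - KL n w \<omega> - \<kappa> n = - (2 / \<phi>) * (?e \<bullet> ?h) + lam n * ?pen"
      unfolding KL_eq G KL_star_def criterion_def \<kappa>_def e by (rule alg)
    \<comment> \<open>along \<open>\<beta>hat - \<beta>star\<close> both factors are small; along \<open>\<beta>star\<close> only finitely many fixed directions occur\<close>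
    also have "?e \<bullet> ?h = ?e \<bullet> (?h - ?s) + (\<Sum>s=1..S. w s * N s n \<omega>)"
    proof -
      have "?e \<bullet> ?s = (\<Sum>s=1..S. w s * N s n \<omega>)"
        unfolding avg_inner N_def by (simp add: inner_sum_left)
      then show ?thesis by (simp add: inner_diff_right)
    qed
    finally have eq: "G n w \<omega> - KL n w \<omega> - \<kappa> n
        = - (2 / \<phi>) * (?e \<bullet> (?h - ?s) + (\<Sum>s=1..S. w s * N s n \<omega>)) + lam n * ?pen" .
    have "\<bar>G n w \<omega> - KL n w \<omega> - \<kappa> n\<bar>
        \<le> \<bar>2 / \<phi>\<bar> * \<bar>?e \<bullet> (?h - ?s) + (\<Sum>s=1..S. w s * N s n \<omega>)\<bar> + \<bar>lam n\<bar> * \<bar>?pen\<bar>"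
      unfolding eq by (rule order_trans[OF abs_triangle_ineq]) (simp only: abs_mult abs_minus_cancel order_refl)
    also have "\<dots> \<le> \<bar>2 / \<phi>\<bar> * (eX n \<omega> * D n \<omega> + (\<Sum>s=1..S. \<bar>N s n \<omega>\<bar>)) + \<bar>lam n\<bar> * real CARD('k)"
    proof (intro add_mono mult_left_mono)
      have "\<bar>?e \<bullet> (?h - ?s)\<bar> \<le> eX n \<omega> * D n \<omega>"
        using Cauchy_Schwarz_ineq2 avg_close[OF w] unfolding eX_def
        by (rule order_trans[OF _ mult_left_mono]) auto
      then show "\<bar>?e \<bullet> (?h - ?s) + (\<Sum>s=1..S. w s * N s n \<omega>)\<bar>
          \<le> eX n \<omega> * D n \<omega> + (\<Sum>s=1..S. \<bar>N s n \<omega>\<bar>)"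
        using weighted_sum_abs_le[OF w, of "\<lambda>s. N s n \<omega>"] by linarith
      have "?pen \<le> (\<Sum>s=1..S. w s * real CARD('k))"
        using weights_bounds[OF w] by (intro sum_mono mult_left_mono) (auto intro: card_mono)
      also have "\<dots> = real CARD('k)"
        using w by (simp add: weights_def flip: sum_distrib_right)
      finally have "?pen \<le> real CARD('k)" .
      moreover have "0 \<le> ?pen"
        using weights_bounds[OF w] by (intro sum_nonneg mult_nonneg_nonneg) auto
      ultimately show "\<bar>?pen\<bar> \<le> real CARD('k)" by linarith
    qed auto
    also have "\<dots> \<le> U n w \<omega>"
    proof -
      have "0 \<le> g n w \<omega> * D n \<omega>" "0 \<le> mX n * D n \<omega>"
        using D_nonneg by (auto simp: g_def mX_def)
      then have "\<bar>2 / \<phi>\<bar> * (eX n \<omega> * D n \<omega> + (\<Sum>s=1..S. \<bar>N s n \<omega>\<bar>))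
          \<le> \<bar>2 / \<phi>\<bar> * (g n w \<omega> * D n \<omega> + mX n * D n \<omega> + eX n \<omega> * D n \<omega> + (\<Sum>s=1..S. \<bar>N s n \<omega>\<bar>))"
        by (intro mult_left_mono) auto
      then show ?thesis by (simp add: U_def mult.commute)
    qed
    finally show ?thesis .
  qed

  have D_rate: "Op_unif M ?W (\<lambda>n w. D n) (\<lambda>n. real n powr (-1/2))"
    unfolding D_def using cond_i by (intro Op_unif_sum Op_unif_const_index) auto
  have rate: "(\<lambda>n. real n * real n powr (-1/2)) = ?R"
    by (rule ext) (simp add: powr_mult_base)
  have "Op_unif M ?W g (\<lambda>n. real n)"
    unfolding g_def by (intro cond_ii_B[rule_format] z)
  then have g_rate: "Op_unif M ?W (\<lambda>n w \<omega>. g n w \<omega> * D n \<omega>) ?R"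
    unfolding rate[symmetric] by (rule Op_unif_mult[OF _ D_rate])
  have "Op_unif M ?W (\<lambda>n w \<omega>. mX n) (\<lambda>n. real n)"
    unfolding mX_def by (rule Op_unif_deterministic[OF cond_ii_mu]) simp
  then have mX_rate: "Op_unif M ?W (\<lambda>n w \<omega>. mX n * D n \<omega>) ?R"
    unfolding rate[symmetric] by (rule Op_unif_mult[OF _ D_rate])
  have eX_rate: "Op_unif M ?W (\<lambda>n w \<omega>. eX n \<omega> * D n \<omega>) ?R"
  proof (rule Op_unif_bigo)
    show "Op_unif M ?W (\<lambda>n w \<omega>. eX n \<omega> * D n \<omega>) (\<lambda>n. ?R n * real n powr (-1/2))"
      unfolding eX_def by (rule Op_unif_mult[OF Op_unif_const_index[OF cond_ii_eps] D_rate])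
    have "\<forall>\<^sub>F n in sequentially. norm (?R n * real n powr (-1/2)) \<le> 1 * norm (?R n)"
      using eventually_ge_at_top[of 1]
    proof eventually_elim
      case (elim n)
      then have "real n powr (-1/2) \<le> real n powr 0" by (intro powr_mono) auto
      with elim show ?case by (simp add: mult_left_le)
    qed
    then show "(\<lambda>n. ?R n * real n powr (-1/2)) \<in> O(?R)" by (rule landau_o.bigI[rotated]) simp
  qed simp
  have N_rate: "Op_unif M ?W (\<lambda>n w \<omega>. \<Sum>s=1..S. \<bar>N s n \<omega>\<bar>) ?R"
  proof (rule Op_unif_sum)
    fix s assume s: "s \<in> {1..S}"
    obtain C where C: "\<forall>\<^sub>F n in sequentially. \<forall>s\<in>{1..S}.
        \<sigma>2 n * (\<Sum>i=1..n. (Xt n i \<bullet> \<beta>star n s)\<^sup>2) / real n \<le> C"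
      using cond_iii by blast
    have "Op M (N s) ?R"
      unfolding N_def
    proof (rule Op_weighted_sum_indep[OF prob])
      fix n
      interpret prob_space "M n" by (rule prob)
      have \<epsilon>_eq: "\<epsilon> n = (\<lambda>i \<omega>. y n i \<omega> - \<mu> n i)"
        by (intro ext eps)
      show "indep_vars (\<lambda>_. borel) (\<epsilon> n) {1..n}"
        unfolding \<epsilon>_eq using indep_vars_compose2[OF indep, of "\<lambda>i t. t - \<mu> n i" "\<lambda>_. borel"] by simp
      fix i assume i: "i \<in> {1..n}"
      note Y = response_integrable[OF dens[OF i]] response_square_integrable[OF dens[OF i]]
      show "integrable (M n) (\<lambda>\<omega>. (\<epsilon> n i \<omega>)\<^sup>2)"
        using Y by (simp add: eps power2_diff)
      show "expectation (\<epsilon> n i) = 0"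
        using Y unfolding \<epsilon>_eq by (simp add: mu prob_space)
    next
      show "\<forall>\<^sub>F n in sequentially. (MAX i\<in>{1..n}. prob_space.variance (M n) (\<epsilon> n i))
          * (\<Sum>i=1..n. (Xt n i \<bullet> \<beta>star n s)\<^sup>2) / real n \<le> C"
        using C s by (auto elim!: eventually_mono simp: sigma)
    qed
    then have "Op_unif M ?W (\<lambda>n w. N s n) ?R" by (rule Op_unif_const_index)
    then show "Op_unif M ?W (\<lambda>n w \<omega>. \<bar>N s n \<omega>\<bar>) ?R" by (rule Op_unif_mono) simp
  qed auto
  have lam_rate: "Op_unif M ?W (\<lambda>n w \<omega>. \<bar>lam n\<bar>) ?R"
  proof (rule Op_unif_deterministic)
    have prod: "(\<lambda>n. ?R n * (real n powr (-1/2) * lam n)) \<in> O(\<lambda>n. ?R n * 1)"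
      using cond_v by (intro landau_o.big.mult) auto
    have ev: "\<forall>\<^sub>F n in sequentially. ?R n * (real n powr (-1/2) * lam n) = lam n"
      using eventually_ge_at_top[of 1]
      by eventually_elim (simp flip: mult.assoc powr_add)
    have "lam \<in> O(\<lambda>n. ?R n * 1)"
      using landau_o.big.in_cong[OF ev] prod by (rule iffD1)
    then show "(\<lambda>n. \<bar>lam n\<bar>) \<in> O(?R)" by simp
  qed simp
  have U_rate: "Op_unif M ?W U ?R"
    unfolding U_def using g_rate mX_rate eX_rate N_rate lam_rate
    by (intro Op_unif_add Op_unif_cmult)

  \<comment> \<open>the selected weights witness that infima over the weights range over a non-empty set\<close>
  have W_nonempty: "?W \<noteq> {}"
  proof -
    obtain \<omega> where "\<omega> \<in> space (M 0)"
      using prob_space.not_empty[OF prob] by blast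
    then show ?thesis using what[of \<omega> 0] by (auto simp: is_arg_min_def)
  qed
  have \<xi>_le: "\<xi> n \<le> KLstar n w" if "w \<in> ?W" for n w
    unfolding xi using KLstar_nonneg that by (intro cINF_lower bdd_belowI2[of _ 0])
  have "0 \<le> \<xi> n" for n
    unfolding xi using KLstar_nonneg W_nonempty by (intro cINF_greatest)
  then have \<xi>_pos: "\<forall>\<^sub>F n in sequentially. \<xi> n > 0"
    using cond_iv(1) by (auto elim!: eventually_mono simp: less_le)
  have R_small: "?R \<in> o(\<xi>)"
  proof (rule landau_o.smallI)
    fix a :: real assume "a > 0"
    then have "a\<^sup>2 > 0" by simp
    have "\<forall>\<^sub>F n in sequentially. norm (real n / (\<xi> n)\<^sup>2) \<le> a\<^sup>2 * norm (1 :: real)"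
      by (rule landau_o.smallD[OF cond_iv(2) \<open>a\<^sup>2 > 0\<close>])
    with cond_iv(1) show "\<forall>\<^sub>F n in sequentially. norm (?R n) \<le> a * norm (\<xi> n)"
    proof eventually_elim
      case (elim n)
      then have "real n \<le> (a * \<bar>\<xi> n\<bar>)\<^sup>2"
        by (simp add: field_simps power_mult_distrib)
      then have "sqrt (real n) \<le> a * \<bar>\<xi> n\<bar>"
        using \<open>a > 0\<close> by (intro real_le_lsqrt) auto
      then show ?case by (simp add: powr_half_sqrt)
    qed
  qed

  show ?thesis
    unfolding tendsto_in_prob_def
  proof (intro allI impI)
    fix \<delta> :: real assume \<delta>: "\<delta> > 0"
    \<comment> \<open>the solution of \<open>2 * a / (1 - a) = \<delta>\<close>\<close>
    define a where "a = \<delta> / (2 + \<delta>)"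
    have a: "0 < a" "a < 1" "2 * a / (1 - a) = \<delta>"
      using \<delta> by (auto simp: a_def field_simps)
    let ?bad = "\<lambda>n. {\<omega> \<in> space (M n). \<bar>KL n (what n \<omega>) \<omega> / (INF w\<in>?W. KL n w \<omega>) - 1\<bar> > \<delta>}"
    let ?exc = "\<lambda>n. {\<omega> \<in> space (M n). \<exists>w\<in>?W. \<bar>U n w \<omega>\<bar> > a * \<xi> n}"
    have "\<forall>\<^sub>F n in sequentially. outer_measure_of (M n) (?bad n) \<le> outer_measure_of (M n) (?exc n)"
      using \<xi>_pos
    proof eventually_elim
      case (elim n)
      have "?bad n \<subseteq> ?exc n"
      proof (rule subsetI, rule ccontr)
        fix \<omega> assume bad: "\<omega> \<in> ?bad n" and "\<omega> \<notin> ?exc n"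
        then have \<omega>: "\<omega> \<in> space (M n)" and U: "\<And>w. w \<in> ?W \<Longrightarrow> U n w \<omega> \<le> a * \<xi> n"
          by force+
        have "\<bar>KL n (what n \<omega>) \<omega> / (INF w\<in>?W. KL n w \<omega>) - 1\<bar> \<le> 2 * a / (1 - a)"
        proof (rule argmin_loss_ratio[where Ls = "KLstar n" and \<kappa> = "\<kappa> n"])
          show "is_arg_min (\<lambda>w. G n w \<omega>) (\<lambda>w. w \<in> ?W) (what n \<omega>)"
            by (rule what[OF \<omega>])
          show "\<bar>KL n w \<omega> - KLstar n w\<bar> \<le> a * \<xi> n" "\<bar>G n w \<omega> - KL n w \<omega> - \<kappa> n\<bar> \<le> a * \<xi> n"
            if "w \<in> ?W" for w
            using loss_close[OF that] criterion_close[OF that] U[OF that] order_trans by blast+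
        qed (use a elim \<xi>_le in auto)
        with bad show False by (simp add: a(3))
      qed
      then show ?case by (rule outer_measure_of_mono)
    qed
    then show "(\<lambda>n. outer_measure_of (M n) (?bad n)) \<longlonglongrightarrow> 0"
      by (rule tendsto_sandwich[OF always_eventually[OF allI[OF zero_le]] _ tendsto_const
            Op_unif_smallo_exceedance[OF U_rate R_small _ \<xi>_pos a(1)]]) simp
  qed
qed

end
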